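(* Let $(\omega^1,\omega^2,\omega^3)$ be a coframing of a 3-manifold $M$ such that $\omega^1$ and $\omega^2$ form a bi-contact structure, with sign $\epsilon$ and invariant function $C$. Away from the critical set of $C$ we may adapt the coframing to one of the following structure equations: (1) If $C_3=0$ then $$\begin{aligned} d\omega^1&=(A_3-C)\,\omega^1\wedge\omega^3+\omega^2\wedge\omega^3,\\ d\omega^2&=\epsilon\,\omega^1\wedge\omega^3+(A_3+C)\,\omega^2\wedge\omega^3,\\ d\omega^3&=B_3\,\omega^1\wedge\omega^2+B_2\,\omega^1\wedge\omega^3+B_1\,\omega^2\wedge\omega^3,\\ dC&=\cos(\xi)\,\omega^1+\delta\sin(\xi)\,\omega^2.\end{aligned}$$ (2) If $C_3\neq0$ then $C_1=C_2=0$, and if $dC\wedge dC_3\neq0$ then $$\begin{aligned} d\omega^1&=A_2\,\omega^1\wedge\omega^2+(A_3-C)\,\omega^1\wedge\omega^3+\omega^2\wedge\omega^3,\\ d\omega^2&=-A_1\,\omega^1\wedge\omega^2+\epsilon\,\omega^1\wedge\omega^3+(A_3+C)\,\omega^2\wedge\omega^3,\\ d\omega^3&=\delta\sin(\zeta)\,\omega^1\wedge\omega^3+\cos(\zeta)\,\omega^2\wedge\omega^3,\\ dC&=C_3\,\omega^3.\end{aligned}$$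
   Context: A bi-contact structure on an orientable 3-manifold $M$ is a pair of contact 1-forms $(\omega^1,\omega^2)$ with $\ker\omega^1(p)\neq\ker\omega^2(p)$ for every $p$. Adapting a coframing means replacing it by $g^{-1}\omega$, with $g$ a function valued in invertible matrices of the form $\begin{bmatrix} a_1 & 0 & 0 \\ 0 & a_2 & 0 \\ b_1 & b_2 & b_3 \end{bmatrix}$, so that the two contact distributions are unchanged. A coframe is 1-adapted if $\omega^1\wedge d\omega^1=-\epsilon\,\omega^2\wedge d\omega^2=\omega^1\wedge\omega^2\wedge\omega^3$, where $\epsilon=\pm1$; 1-adapted coframes are related by such $g$ with $a_1=a$, $a_2=\delta a$, $b_3=\delta$, $\delta=\pm1$. In a 1-adapted coframe the invariant $C$ is given by $\omega^1\wedge d\omega^2+\omega^2\wedge d\omega^1=2C\,\omega^1\wedge\omega^2\wedge\omega^3$, and one writes $dC=C_1\omega^1+C_2\omega^2+C_3\omega^3$, so $C_3=0$ means $dC\wedge\omega^1\wedge\omega^2=0$. In (2), $C_1=C_2=0$ holds for the adapted coframing. The symbols $A_1,A_2,A_3,B_1,B_2,B_3,\xi,\zeta$ denote functions on $M$, and $\delta=\pm1$.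
   Formalization: Case (1) as stated is false where A_3^2-C^2-ε=0 (with A_3 forced by d(dC)=0): dω^1, dω^2 may keep ω^1∧ω^2 terms. Their vanishing is proved only if A_3^2-C^2-ε≠0 on the whole open set considered. ξ, ζ are smooth functions modulo 2π. *)

theory Defs
  imports "HOL-Analysis.Analysis"
begin

section \<open>Smooth 3-manifolds\<close>

text \<open>\<open>C\<^sup>k\<close> and \<open>C\<^sup>\<infinity>\<close> maps on an open subset of a Euclidean space.\<close>

fun Ck_on :: "nat \<Rightarrow> 'a::euclidean_space set \<Rightarrow> ('a \<Rightarrow> 'b::real_normed_vector) \<Rightarrow> bool" where
  "Ck_on 0 S f \<longleftrightarrow> continuous_on S f"
| "Ck_on (Suc k) S f \<longleftrightarrow>
     (\<forall>x\<in>S. f differentiable (at x)) \<and> (\<forall>v. Ck_on k S (\<lambda>x. frechet_derivative f (at x) v))"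

definition smooth_on :: "'a::euclidean_space set \<Rightarrow> ('a \<Rightarrow> 'b::real_normed_vector) \<Rightarrow> bool" where
  "smooth_on S f \<longleftrightarrow> (\<forall>k. Ck_on k S f)"

text \<open>A chart is a pair of its domain and its coordinate map. The underlying space of the
  manifold is the whole type \<open>'m\<close>; the Hausdorff and second countability axioms are the
  sort constraints.\<close>

type_synonym 'm chart = "'m set \<times> ('m \<Rightarrow> real^3)"

definition chart_inv :: "'m chart \<Rightarrow> real^3 \<Rightarrow> 'm" where
  "chart_inv c = inv_into (fst c) (snd c)"

definition manifold3 :: "('m::{t2_space,second_countable_topology}) chart set \<Rightarrow> bool" where
  "manifold3 A \<longleftrightarrow>
     (\<Union>c\<in>A. fst c) = UNIV \<and>
     (\<forall>c\<in>A. open (fst c) \<and> open (snd c ` fst c) \<and>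
        homeomorphism (fst c) (snd c ` fst c) (snd c) (chart_inv c)) \<and>
     (\<forall>c\<in>A. \<forall>c'\<in>A. smooth_on (snd c ` (fst c \<inter> fst c')) (snd c' \<circ> chart_inv c))"

definition smooth_fun ::
  "('m::{t2_space,second_countable_topology}) chart set \<Rightarrow> 'm set \<Rightarrow> ('m \<Rightarrow> real) \<Rightarrow> bool" where
  "smooth_fun A U f \<longleftrightarrow> (\<forall>c\<in>A. smooth_on (snd c ` (fst c \<inter> U)) (f \<circ> chart_inv c))"

text \<open>A smooth function into \<open>\<real> / 2\<pi>\<int>\<close>, given by real representatives.\<close>

definition smooth_angle ::
  "('m::{t2_space,second_countable_topology}) chart set \<Rightarrow> 'm set \<Rightarrow> ('m \<Rightarrow> real) \<Rightarrow> bool" where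
  "smooth_angle A U \<xi> \<longleftrightarrow>
     (\<forall>p\<in>U. \<exists>V f. open V \<and> p \<in> V \<and> V \<subseteq> U \<and> smooth_fun A V f \<and>
        (\<forall>q\<in>V. \<exists>k::int. \<xi> q = f q + 2 * pi * of_int k))"

section \<open>Differential forms\<close>

text \<open>A \<open>k\<close>-form is given by its coordinate expression in every chart:
  \<open>\<alpha> c p v\<^sub>1 \<dots> v\<^sub>k\<close> is its value at \<open>p\<close> on the tangent vectors having
  components \<open>v\<^sub>1, \<dots>, v\<^sub>k\<close> in the chart \<open>c\<close>.
  Only values with \<open>p \<in> fst c\<close> are meaningful, so forms are compared by \<open>forms_eq\<close>.\<close>

type_synonym 'm form1 = "'m chart \<Rightarrow> 'm \<Rightarrow> real^3 \<Rightarrow> real"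
type_synonym 'm form2 = "'m chart \<Rightarrow> 'm \<Rightarrow> real^3 \<Rightarrow> real^3 \<Rightarrow> real"
type_synonym 'm form3 = "'m chart \<Rightarrow> 'm \<Rightarrow> real^3 \<Rightarrow> real^3 \<Rightarrow> real^3 \<Rightarrow> real"

definition forms_eq ::
  "'m chart set \<Rightarrow> 'm set \<Rightarrow> ('m chart \<Rightarrow> 'm \<Rightarrow> 'v) \<Rightarrow> ('m chart \<Rightarrow> 'm \<Rightarrow> 'v) \<Rightarrow> bool" where
  "forms_eq A U \<alpha> \<beta> \<longleftrightarrow> (\<forall>c\<in>A. \<forall>p\<in>fst c \<inter> U. \<alpha> c p = \<beta> c p)"

text \<open>Smooth 1-forms on \<open>U\<close>; the second condition is the transformation law of covectors.\<close>

definition one_form_on ::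
  "('m::{t2_space,second_countable_topology}) chart set \<Rightarrow> 'm set \<Rightarrow> 'm form1 \<Rightarrow> bool" where
  "one_form_on A U \<alpha> \<longleftrightarrow>
     (\<forall>c\<in>A. \<forall>p\<in>fst c \<inter> U. linear (\<alpha> c p)) \<and>
     (\<forall>c\<in>A. \<forall>c'\<in>A. \<forall>p\<in>fst c \<inter> fst c' \<inter> U. \<forall>v.
        \<alpha> c p v = \<alpha> c' p (frechet_derivative (snd c' \<circ> chart_inv c) (at (snd c p)) v)) \<and>
     (\<forall>c\<in>A. \<forall>v. smooth_on (snd c ` (fst c \<inter> U)) (\<lambda>x. \<alpha> c (chart_inv c x) v))"

definition wedge11 :: "'m form1 \<Rightarrow> 'm form1 \<Rightarrow> 'm form2" where
  "wedge11 \<alpha> \<beta> = (\<lambda>c p u v. \<alpha> c p u * \<beta> c p v - \<alpha> c p v * \<beta> c p u)"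

definition wedge12 :: "'m form1 \<Rightarrow> 'm form2 \<Rightarrow> 'm form3" where
  "wedge12 \<alpha> \<gamma> = (\<lambda>c p u v w.
     \<alpha> c p u * \<gamma> c p v w - \<alpha> c p v * \<gamma> c p u w + \<alpha> c p w * \<gamma> c p u v)"

definition d0 :: "('m \<Rightarrow> real) \<Rightarrow> 'm form1" where
  "d0 f = (\<lambda>c p u. frechet_derivative (f \<circ> chart_inv c) (at (snd c p)) u)"

definition d1 :: "'m form1 \<Rightarrow> 'm form2" where
  "d1 \<alpha> = (\<lambda>c p u v.
     frechet_derivative (\<lambda>x. \<alpha> c (chart_inv c x) v) (at (snd c p)) u
   - frechet_derivative (\<lambda>x. \<alpha> c (chart_inv c x) u) (at (snd c p)) v)"

text \<open>\<open>f\<^sub>1 \<omega>\<^sup>1 + f\<^sub>2 \<omega>\<^sup>2 + f\<^sub>3 \<omega>\<^sup>3\<close>, and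
  \<open>f\<^sub>1\<^sub>2 \<omega>\<^sup>1 \<and> \<omega>\<^sup>2 + f\<^sub>1\<^sub>3 \<omega>\<^sup>1 \<and> \<omega>\<^sup>3 + f\<^sub>2\<^sub>3 \<omega>\<^sup>2 \<and> \<omega>\<^sup>3\<close>,
  and \<open>\<omega>\<^sup>1 \<and> \<omega>\<^sup>2 \<and> \<omega>\<^sup>3\<close>.\<close>

definition comb1 ::
  "(3 \<Rightarrow> 'm form1) \<Rightarrow> ('m \<Rightarrow> real) \<Rightarrow> ('m \<Rightarrow> real) \<Rightarrow> ('m \<Rightarrow> real) \<Rightarrow> 'm form1" where
  "comb1 \<omega> f1 f2 f3 = (\<lambda>c p u. f1 p * \<omega> 1 c p u + f2 p * \<omega> 2 c p u + f3 p * \<omega> 3 c p u)"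

definition comb2 ::
  "(3 \<Rightarrow> 'm form1) \<Rightarrow> ('m \<Rightarrow> real) \<Rightarrow> ('m \<Rightarrow> real) \<Rightarrow> ('m \<Rightarrow> real) \<Rightarrow> 'm form2" where
  "comb2 \<omega> f12 f13 f23 = (\<lambda>c p u v.
     f12 p * wedge11 (\<omega> 1) (\<omega> 2) c p u v
   + f13 p * wedge11 (\<omega> 1) (\<omega> 3) c p u v
   + f23 p * wedge11 (\<omega> 2) (\<omega> 3) c p u v)"

definition vol :: "(3 \<Rightarrow> 'm form1) \<Rightarrow> 'm form3" where
  "vol \<omega> = wedge12 (\<omega> 1) (wedge11 (\<omega> 2) (\<omega> 3))"

section \<open>Coframings and bi-contact structures\<close>

definition coframing_on ::
  "('m::{t2_space,second_countable_topology}) chart set \<Rightarrow> 'm set \<Rightarrow> (3 \<Rightarrow> 'm form1) \<Rightarrow> bool" where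
  "coframing_on A U \<omega> \<longleftrightarrow>
     (\<forall>i. one_form_on A U (\<omega> i)) \<and>
     (\<forall>c\<in>A. \<forall>p\<in>fst c \<inter> U. \<forall>a::3 \<Rightarrow> real.
        (\<forall>v. (\<Sum>i\<in>UNIV. a i * \<omega> i c p v) = 0) \<longrightarrow> (\<forall>i. a i = 0))"

definition contact_on ::
  "('m::{t2_space,second_countable_topology}) chart set \<Rightarrow> 'm set \<Rightarrow> 'm form1 \<Rightarrow> bool" where
  "contact_on A U \<alpha> \<longleftrightarrow> one_form_on A U \<alpha> \<and>
     (\<forall>c\<in>A. \<forall>p\<in>fst c \<inter> U. wedge12 \<alpha> (d1 \<alpha>) c p \<noteq> (\<lambda>u v w. 0))"

definition bicontact_on ::
  "('m::{t2_space,second_countable_topology}) chart set \<Rightarrow> 'm set \<Rightarrow> 'm form1 \<Rightarrow> 'm form1 \<Rightarrow> bool" where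
  "bicontact_on A U \<alpha> \<beta> \<longleftrightarrow> contact_on A U \<alpha> \<and> contact_on A U \<beta> \<and>
     (\<forall>c\<in>A. \<forall>p\<in>fst c \<inter> U. {v. \<alpha> c p v = 0} \<noteq> {v. \<beta> c p v = 0})"

text \<open>\<open>\<eta> = g\<^sup>-\<^sup>1 \<omega>\<close> on \<open>U\<close>, with \<open>g\<close> preserving the two contact distributions.\<close>

definition adaptation ::
  "('m::{t2_space,second_countable_topology}) chart set \<Rightarrow> 'm set \<Rightarrow>
   (3 \<Rightarrow> 'm form1) \<Rightarrow> (3 \<Rightarrow> 'm form1) \<Rightarrow> bool" where
  "adaptation A U \<omega> \<eta> \<longleftrightarrow> coframing_on A U \<eta> \<and>
     (\<exists>g :: 'm \<Rightarrow> real^3^3.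
        (\<forall>i j. smooth_fun A U (\<lambda>p. g p $ i $ j)) \<and>
        (\<forall>p\<in>U. invertible (g p) \<and>
           g p $ 1 $ 2 = 0 \<and> g p $ 1 $ 3 = 0 \<and> g p $ 2 $ 1 = 0 \<and> g p $ 2 $ 3 = 0) \<and>
        (\<forall>i. forms_eq A U (\<eta> i)
           (\<lambda>c p v. \<Sum>j\<in>UNIV. matrix_inv (g p) $ i $ j * \<omega> j c p v)))"

definition one_adapted ::
  "('m::{t2_space,second_countable_topology}) chart set \<Rightarrow> 'm set \<Rightarrow> real \<Rightarrow> (3 \<Rightarrow> 'm form1) \<Rightarrow> bool" where
  "one_adapted A U \<epsilon> \<omega> \<longleftrightarrow> coframing_on A U \<omega> \<and>
     forms_eq A U (wedge12 (\<omega> 1) (d1 (\<omega> 1))) (vol \<omega>) \<and>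
     forms_eq A U (\<lambda>c p u v w. - \<epsilon> * wedge12 (\<omega> 2) (d1 (\<omega> 2)) c p u v w) (vol \<omega>)"

definition invariant_C ::
  "('m::{t2_space,second_countable_topology}) chart set \<Rightarrow> 'm set \<Rightarrow>
   (3 \<Rightarrow> 'm form1) \<Rightarrow> ('m \<Rightarrow> real) \<Rightarrow> bool" where
  "invariant_C A U \<omega> C \<longleftrightarrow> smooth_fun A U C \<and>
     forms_eq A U
       (\<lambda>c p u v w. wedge12 (\<omega> 1) (d1 (\<omega> 2)) c p u v w + wedge12 (\<omega> 2) (d1 (\<omega> 1)) c p u v w)
       (\<lambda>c p u v w. 2 * C p * vol \<omega> c p u v w)"

text \<open>Suppose \<open>C\<^sub>3 = 0\<close> and \<open>dC \<noteq> 0\<close>. The 1-adapted coframings with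
  \<open>C\<^sub>1\<^sup>2 + C\<^sub>2\<^sup>2 = 1\<close> satisfy
  \<open>d\<omega>\<^sup>1 = A\<^sub>2 \<omega>\<^sup>1\<and>\<omega>\<^sup>2 + (A\<^sub>3-C) \<omega>\<^sup>1\<and>\<omega>\<^sup>3 + \<omega>\<^sup>2\<and>\<omega>\<^sup>3\<close> and
  \<open>d\<omega>\<^sup>2 = -A\<^sub>1 \<omega>\<^sup>1\<and>\<omega>\<^sup>2 + \<epsilon> \<omega>\<^sup>1\<and>\<omega>\<^sup>3 + (A\<^sub>3+C) \<omega>\<^sup>2\<and>\<omega>\<^sup>3\<close>,
  where \<open>d(dC) = 0\<close> forces
  \<open>A\<^sub>3 = C (C\<^sub>1\<^sup>2 - C\<^sub>2\<^sup>2) - (1 + \<epsilon>) C\<^sub>1 C\<^sub>2\<close>.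
  The remaining freedom \<open>\<omega>\<^sup>3 \<mapsto> \<omega>\<^sup>3 + b\<^sub>1 \<omega>\<^sup>1 + b\<^sub>2 \<omega>\<^sup>2\<close> moves
  \<open>(A\<^sub>2, -A\<^sub>1)\<close> by a linear map of \<open>(b\<^sub>1, b\<^sub>2)\<close> with determinant
  \<open>A\<^sub>3\<^sup>2 - C\<^sup>2 - \<epsilon>\<close>. Where that determinant vanishes, \<open>A\<^sub>1\<close> and \<open>A\<^sub>2\<close>
  cannot in general be removed. The formula below is homogeneous of degree 0 in
  \<open>(C\<^sub>1, C\<^sub>2)\<close>, so it can be evaluated in any 1-adapted coframing.\<close>

definition A3_normalized :: "real \<Rightarrow> real \<Rightarrow> real \<Rightarrow> real \<Rightarrow> real" where
  "A3_normalized \<epsilon> C C1 C2 = (C * (C1\<^sup>2 - C2\<^sup>2) - (1 + \<epsilon>) * C1 * C2) / (C1\<^sup>2 + C2\<^sup>2)"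

definition translation_regular :: "real \<Rightarrow> real \<Rightarrow> real \<Rightarrow> real \<Rightarrow> bool" where
  "translation_regular \<epsilon> C C1 C2 \<longleftrightarrow> (A3_normalized \<epsilon> C C1 C2)\<^sup>2 - C\<^sup>2 - \<epsilon> \<noteq> 0"

end

theory Submission
  imports Defs
begin

text \<open>
  In a 1-adapted coframing, \<open>\<omega>\<^sup>1 \<and> d\<omega>\<^sup>1\<close>, \<open>\<omega>\<^sup>2 \<and> d\<omega>\<^sup>2\<close> and
  \<open>\<omega>\<^sup>1 \<and> d\<omega>\<^sup>2 + \<omega>\<^sup>2 \<and> d\<omega>\<^sup>1\<close> fix all coefficients of \<open>d\<omega>\<^sup>1\<close> and \<open>d\<omega>\<^sup>2\<close>
  except \<open>A\<^sub>1, A\<^sub>2, A\<^sub>3\<close>. Rescaling \<open>\<omega>\<^sup>1, \<omega>\<^sup>2\<close> by a common function and adding multiples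
  of them to \<open>\<omega>\<^sup>3\<close> preserves 1-adaptedness and \<open>C\<close>.

  If \<open>C\<^sub>3 = 0\<close>, scaling by \<open>sqrt (C\<^sub>1\<^sup>2 + C\<^sub>2\<^sup>2)\<close> makes \<open>dC\<close> a unit covector. Then
  \<open>d(dC) = 0\<close> determines \<open>A\<^sub>3\<close>, and \<open>A\<^sub>1, A\<^sub>2\<close> are removed by solving a \<open>2 \<times> 2\<close> linear
  system for the translation of \<open>\<omega>\<^sup>3\<close>.

  If \<open>C\<^sub>3 \<noteq> 0\<close>, replacing \<open>\<omega>\<^sup>3\<close> by \<open>dC / C\<^sub>3\<close> gives \<open>dC = C\<^sub>3 \<omega>\<^sup>3\<close>, so that
  \<open>d\<omega>\<^sup>3 = - (dC\<^sub>3 / C\<^sub>3) \<and> \<omega>\<^sup>3 = e\<^sub>1 \<omega>\<^sup>1 \<and> \<omega>\<^sup>3 + e\<^sub>2 \<omega>\<^sup>2 \<and> \<omega>\<^sup>3\<close>, where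
  \<open>(e\<^sub>1, e\<^sub>2) \<noteq> 0\<close> because \<open>dC \<and> dC\<^sub>3 \<noteq> 0\<close>. Scaling by \<open>sqrt (e\<^sub>1\<^sup>2 + e\<^sub>2\<^sup>2)\<close> normalizes it.
\<close>

section \<open>Calculus of smooth functions\<close>

text \<open>Differentiability is demanded in the full space, \<open>at x\<close> and not within
  \<open>S\<close>, so restriction needs no openness.\<close>

lemma Ck_on_subset: "Ck_on k S f \<Longrightarrow> T \<subseteq> S \<Longrightarrow> Ck_on k T f"
  by (induction k arbitrary: f) (auto intro: continuous_on_subset)

text \<open>A derivative at x sees only values near x. On an open set, equal functions therefore
  have equal derivatives, and the induction continues with those.\<close>

lemma Ck_on_cong:
  assumes "open S" "\<And>x. x \<in> S \<Longrightarrow> f x = g x" "Ck_on k S f"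
  shows "Ck_on k S g"
  using assms(2,3)
proof (induction k arbitrary: f g)
  case 0
  then show ?case by (metis Ck_on.simps(1) continuous_on_cong)
next
  case (Suc k)
  have diff: "f differentiable at x" if "x \<in> S" for x
    using Suc.prems that by simp
  have eq: "frechet_derivative f (at x) = frechet_derivative g (at x)" if "x \<in> S" for x
    using frechet_derivative_transform_within_open[OF diff[OF that] \<open>open S\<close> that] Suc.prems(1) by blast
  have "g differentiable at x" if "x \<in> S" for x
    using diff[OF that] has_derivative_transform_within_open[OF _ \<open>open S\<close> that] Suc.prems(1)
    unfolding differentiable_def by blast
  moreover have "Ck_on k S (\<lambda>x. frechet_derivative g (at x) v)" for v
    by (rule Suc.IH[of "\<lambda>x. frechet_derivative f (at x) v"]) (use eq Suc.prems in auto)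
  ultimately show ?case by simp
qed

lemma Ck_on_Suc_imp: "Ck_on (Suc k) S f \<Longrightarrow> Ck_on k S f"
proof (induction k arbitrary: f)
  case 0
  then show ?case
    by (auto intro!: continuous_at_imp_continuous_on differentiable_imp_continuous_within)
next
  case (Suc k)
  then show ?case by (metis Ck_on.simps(2))
qed

text \<open>Lets an explicit derivative formula stand in for \<open>frechet_derivative\<close>;
  uniqueness of the derivative identifies the two on \<open>S\<close>.\<close>

lemma Ck_on_SucI:
  assumes "open S" "\<And>x. x \<in> S \<Longrightarrow> (f has_derivative f' x) (at x)"
    and "\<And>v. Ck_on k S (\<lambda>x. f' x v)"
  shows "Ck_on (Suc k) S f"
proof -
  have eq: "frechet_derivative f (at x) = f' x" if "x \<in> S" for x
    using assms(2)[OF that] by (metis frechet_derivative_at)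
  have "Ck_on k S (\<lambda>x. frechet_derivative f (at x) v)" for v
    by (rule Ck_on_cong[OF \<open>open S\<close> _ assms(3)[of v]]) (simp add: eq)
  then show ?thesis using assms(2) by (auto simp: differentiable_def)
qed

lemma Ck_on_SucD:
  assumes "Ck_on (Suc k) S f" "x \<in> S"
  shows "(f has_derivative frechet_derivative f (at x)) (at x)"
  using assms by (simp add: frechet_derivative_works)

lemma Ck_on_const: "open S \<Longrightarrow> Ck_on k S (\<lambda>x. c)"
  by (induction k arbitrary: c) auto

lemma Ck_on_add:
  assumes "open S" "Ck_on k S f" "Ck_on k S g"
  shows "Ck_on k S (\<lambda>x. f x + g x)"
  using assms(2,3)
proof (induction k arbitrary: f g)
  case 0
  then show ?case by (auto intro: continuous_intros)
next
  case (Suc k)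
  show ?case
    by (rule Ck_on_SucI[OF \<open>open S\<close>, where f' = "\<lambda>x v. frechet_derivative f (at x) v + frechet_derivative g (at x) v"])
      (use Suc in \<open>auto intro!: has_derivative_add simp flip: frechet_derivative_works\<close>)
qed

lemma Ck_on_bounded_linear:
  assumes "open S" "bounded_linear L" "Ck_on k S f"
  shows "Ck_on k S (\<lambda>x. L (f x))"
  using assms(3)
proof (induction k arbitrary: f)
  case 0
  then show ?case using assms(2) by (auto intro: bounded_linear.continuous_on)
next
  case (Suc k)
  show ?case
    by (rule Ck_on_SucI[OF \<open>open S\<close>, where f' = "\<lambda>x v. L (frechet_derivative f (at x) v)"])
      (use Suc in \<open>auto intro!: bounded_linear.has_derivative[OF assms(2)] simp flip: frechet_derivative_works\<close>)
qed

lemma Ck_on_mult: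
  fixes f g :: "'a::euclidean_space \<Rightarrow> real"
  assumes "open S" "Ck_on k S f" "Ck_on k S g"
  shows "Ck_on k S (\<lambda>x. f x * g x)"
  using assms(2,3)
proof (induction k arbitrary: f g)
  case 0
  then show ?case by (auto intro: continuous_intros)
next
  case (Suc k)
  show ?case
  proof (rule Ck_on_SucI[OF \<open>open S\<close>])
    show "((\<lambda>x. f x * g x) has_derivative
        (\<lambda>v. f x * frechet_derivative g (at x) v + frechet_derivative f (at x) v * g x)) (at x)"
      if "x \<in> S" for x
      using has_derivative_mult[OF Ck_on_SucD[OF Suc.prems(1) that] Ck_on_SucD[OF Suc.prems(2) that]] .
    \<comment> \<open>The product rule also contains \<open>f\<close> and \<open>g\<close>
      undifferentiated, so both are needed at order \<open>k\<close> as well.\<close>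
    show "Ck_on k S (\<lambda>x. f x * frechet_derivative g (at x) v + frechet_derivative f (at x) v * g x)" for v
      using Suc.prems Suc.prems[THEN Ck_on_Suc_imp] by (intro Ck_on_add \<open>open S\<close> Suc.IH) auto
  qed
qed

text \<open>The derivatives of \<open>1 / f\<close> and \<open>sqrt f\<close> are polynomials in \<open>1 / f\<close>,
  \<open>1 / sqrt f\<close> and the derivative of \<open>f\<close>, so induction on \<open>k\<close> avoids a general chain rule.\<close>

lemma Ck_on_inverse:
  fixes f :: "'a::euclidean_space \<Rightarrow> real"
  assumes "open S" "Ck_on k S f" "\<And>x. x \<in> S \<Longrightarrow> f x \<noteq> 0"
  shows "Ck_on k S (\<lambda>x. inverse (f x))"
  using assms(2)
proof (induction k)
  case 0
  then show ?case using assms(3) by (auto intro!: continuous_intros)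
next
  case (Suc k)
  note inv = Suc.IH[OF Ck_on_Suc_imp[OF Suc.prems]]
  show ?case
  proof (rule Ck_on_SucI[OF \<open>open S\<close>])
    show "((\<lambda>x. inverse (f x)) has_derivative
        (\<lambda>v. (- 1) * (inverse (f x) * frechet_derivative f (at x) v * inverse (f x)))) (at x)"
      if "x \<in> S" for x
      using Deriv.has_derivative_inverse[OF assms(3)[OF that] Ck_on_SucD[OF Suc.prems that]] by simp
    show "Ck_on k S (\<lambda>x. (- 1) * (inverse (f x) * frechet_derivative f (at x) v * inverse (f x)))" for v
      using inv Suc.prems \<open>open S\<close> by (intro Ck_on_mult Ck_on_const) auto
  qed
qed

lemma Ck_on_sqrt:
  fixes f :: "'a::euclidean_space \<Rightarrow> real"
  assumes "open S" "Ck_on k S f" "\<And>x. x \<in> S \<Longrightarrow> f x > 0"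
  shows "Ck_on k S (\<lambda>x. sqrt (f x))"
  using assms(2)
proof (induction k)
  case 0
  then show ?case by (auto intro!: continuous_intros)
next
  case (Suc k)
  have inv: "Ck_on k S (\<lambda>x. inverse (sqrt (f x)))"
    using Suc.IH[OF Ck_on_Suc_imp[OF Suc.prems]] assms(3) \<open>open S\<close>
    by (intro Ck_on_inverse) (auto simp: less_imp_neq[symmetric])
  show ?case
  proof (rule Ck_on_SucI[OF \<open>open S\<close>])
    show "((\<lambda>x. sqrt (f x)) has_derivative
        (\<lambda>v. (1/2) * inverse (sqrt (f x)) * frechet_derivative f (at x) v)) (at x)"
      if "x \<in> S" for x
      using has_derivative_real_sqrt[OF assms(3)[OF that] Ck_on_SucD[OF Suc.prems that]]
      by (simp add: field_simps)
    show "Ck_on k S (\<lambda>x. (1/2) * inverse (sqrt (f x)) * frechet_derivative f (at x) v)" for v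
      using inv Suc.prems \<open>open S\<close> by (intro Ck_on_mult Ck_on_const) auto
  qed
qed

text \<open>The derivative involves only \<open>1 / (1 + f * f)\<close> and the derivative of
  \<open>f\<close>, never \<open>arctan\<close> itself, so a case split on \<open>k\<close> replaces
  the induction.\<close>

lemma Ck_on_arctan:
  fixes f :: "'a::euclidean_space \<Rightarrow> real"
  assumes "open S" "Ck_on k S f"
  shows "Ck_on k S (\<lambda>x. arctan (f x))"
  using assms(2)
proof (cases k)
  case 0
  then show ?thesis using assms(2) by (auto intro!: continuous_intros)
next
  case (Suc k)
  note f = assms(2)[unfolded Suc]
  have pos: "1 + f x * f x \<noteq> 0" for x
    by (smt (verit) zero_le_square)
  show ?thesis unfolding Suc
  proof (rule Ck_on_SucI[OF \<open>open S\<close>])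
    show "((\<lambda>x. arctan (f x)) has_derivative
        (\<lambda>v. inverse (1 + f x * f x) * frechet_derivative f (at x) v)) (at x)"
      if "x \<in> S" for x
      using has_derivative_arctan[OF Ck_on_SucD[OF f that]]
      by (simp add: power2_eq_square mult.commute)
    show "Ck_on k S (\<lambda>x. inverse (1 + f x * f x) * frechet_derivative f (at x) v)" for v
      using f Ck_on_Suc_imp[OF f] \<open>open S\<close> pos
      by (intro Ck_on_mult Ck_on_const Ck_on_inverse Ck_on_add) auto
  qed
qed

lemma smooth_on_subset: "smooth_on S f \<Longrightarrow> T \<subseteq> S \<Longrightarrow> smooth_on T f"
  unfolding smooth_on_def using Ck_on_subset by blast

lemma smooth_on_cong:
  assumes "open S" "smooth_on S f" "\<And>x. x \<in> S \<Longrightarrow> f x = g x"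
  shows "smooth_on S g"
  using assms Ck_on_cong unfolding smooth_on_def by blast

lemma smooth_on_const: "open S \<Longrightarrow> smooth_on S (\<lambda>x. c)"
  by (simp add: smooth_on_def Ck_on_const)

lemma smooth_on_add: "open S \<Longrightarrow> smooth_on S f \<Longrightarrow> smooth_on S g \<Longrightarrow> smooth_on S (\<lambda>x. f x + g x)"
  by (simp add: smooth_on_def Ck_on_add)

lemma smooth_on_bounded_linear:
  "open S \<Longrightarrow> bounded_linear L \<Longrightarrow> smooth_on S f \<Longrightarrow> smooth_on S (\<lambda>x. L (f x))"
  by (simp add: smooth_on_def Ck_on_bounded_linear)

lemma smooth_on_mult:
  fixes f g :: "'a::euclidean_space \<Rightarrow> real"
  shows "open S \<Longrightarrow> smooth_on S f \<Longrightarrow> smooth_on S g \<Longrightarrow> smooth_on S (\<lambda>x. f x * g x)"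
  by (simp add: smooth_on_def Ck_on_mult)

lemma smooth_on_minus: "open S \<Longrightarrow> smooth_on S f \<Longrightarrow> smooth_on S (\<lambda>x. - f x)"
  by (rule smooth_on_bounded_linear[OF _ bounded_linear_minus[OF bounded_linear_ident]])

lemma smooth_on_diff: "open S \<Longrightarrow> smooth_on S f \<Longrightarrow> smooth_on S g \<Longrightarrow> smooth_on S (\<lambda>x. f x - g x)"
  using smooth_on_add[OF _ _ smooth_on_minus, of S f g] by simp

lemma smooth_on_divide:
  fixes f g :: "'a::euclidean_space \<Rightarrow> real"
  assumes "open S" "smooth_on S f" "smooth_on S g" "\<And>x. x \<in> S \<Longrightarrow> g x \<noteq> 0"
  shows "smooth_on S (\<lambda>x. f x / g x)"
  using assms unfolding divide_inverse smooth_on_def by (simp add: Ck_on_mult Ck_on_inverse)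

lemma smooth_on_sqrt:
  fixes f :: "'a::euclidean_space \<Rightarrow> real"
  shows "open S \<Longrightarrow> smooth_on S f \<Longrightarrow> (\<And>x. x \<in> S \<Longrightarrow> f x > 0) \<Longrightarrow> smooth_on S (\<lambda>x. sqrt (f x))"
  by (simp add: smooth_on_def Ck_on_sqrt)

lemma smooth_on_arctan:
  fixes f :: "'a::euclidean_space \<Rightarrow> real"
  shows "open S \<Longrightarrow> smooth_on S f \<Longrightarrow> smooth_on S (\<lambda>x. arctan (f x))"
  by (simp add: smooth_on_def Ck_on_arctan)

lemma smooth_on_imp_has_derivative:
  "smooth_on S f \<Longrightarrow> x \<in> S \<Longrightarrow> (f has_derivative frechet_derivative f (at x)) (at x)"
  unfolding smooth_on_def using Ck_on_SucD by blast

lemma smooth_on_frechet_derivative: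
  "smooth_on S f \<Longrightarrow> smooth_on S (\<lambda>x. frechet_derivative f (at x) v)"
  unfolding smooth_on_def by (metis Ck_on.simps(2))

lemma smooth_on_imp_continuous_on: "smooth_on S f \<Longrightarrow> continuous_on S f"
  unfolding smooth_on_def by (metis Ck_on.simps(1))

section \<open>Symmetry of second derivatives\<close>

lemma line_mean_value:
  fixes f :: "'a::real_normed_vector \<Rightarrow> real"
  assumes "h > 0" "\<And>s. 0 \<le> s \<Longrightarrow> s \<le> h \<Longrightarrow> (f has_derivative f' (a + s *\<^sub>R u)) (at (a + s *\<^sub>R u))"
  shows "\<exists>s. 0 < s \<and> s < h \<and> f (a + h *\<^sub>R u) - f a = h * f' (a + s *\<^sub>R u) u"
proof -
  have "((\<lambda>s. f (a + s *\<^sub>R u)) has_field_derivative f' (a + s *\<^sub>R u) u) (at s)"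
    if "0 \<le> s" "s \<le> h" for s
  proof -
    have "((\<lambda>s. f (a + s *\<^sub>R u)) has_derivative (\<lambda>t. f' (a + s *\<^sub>R u) (t *\<^sub>R u))) (at s)"
      by (rule has_derivative_compose[of "\<lambda>s. a + s *\<^sub>R u", OF _ assms(2)[OF that]])
        (auto intro!: derivative_eq_intros)
    moreover have "linear (f' (a + s *\<^sub>R u))"
      using assms(2)[OF that] has_derivative_linear by blast
    ultimately show ?thesis
      by (simp add: linear_cmul has_field_derivative_def mult_commute_abs)
  qed
  from MVT2[OF assms(1) this] show ?thesis by auto
qed

text \<open>Both mixed derivatives are limits of
  \<open>(F (x + hu + hv) - F (x + hu) - F (x + hv) + F x) / h\<^sup>2\<close>, by the mean value theorem
  applied in each direction.\<close>

lemma second_difference: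
  fixes F :: "'a::euclidean_space \<Rightarrow> real"
  assumes h: "h > 0" and F: "smooth_on W F"
    and W: "\<And>s t. \<lbrakk>0 \<le> s; s \<le> h; 0 \<le> t; t \<le> h\<rbrakk> \<Longrightarrow> x + s *\<^sub>R u + t *\<^sub>R v \<in> W"
  shows "\<exists>s t. 0 < s \<and> s < h \<and> 0 < t \<and> t < h \<and>
    F (x + h *\<^sub>R u + h *\<^sub>R v) - F (x + h *\<^sub>R u) - F (x + h *\<^sub>R v) + F x =
    h * h * frechet_derivative (\<lambda>y. frechet_derivative F (at y) u) (at (x + s *\<^sub>R u + t *\<^sub>R v)) v"
proof -
  let ?D = "\<lambda>y. frechet_derivative F (at y)"
  have D: "(F has_derivative ?D y) (at y)" if "y \<in> W" for y
    using smooth_on_imp_has_derivative[OF F that] .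
  \<comment> \<open>Direction u first: the mean value theorem is applied to the increment
    \<open>F (y + h v) - F y\<close> as a function of y.\<close>
  have 1: "((\<lambda>y. F (y + h *\<^sub>R v) - F y) has_derivative
      (\<lambda>w. ?D (x + s *\<^sub>R u + h *\<^sub>R v) w - ?D (x + s *\<^sub>R u) w)) (at (x + s *\<^sub>R u))"
    if "0 \<le> s" "s \<le> h" for s
  proof (rule has_derivative_diff)
    show "((\<lambda>y. F (y + h *\<^sub>R v)) has_derivative ?D (x + s *\<^sub>R u + h *\<^sub>R v)) (at (x + s *\<^sub>R u))"
      by (rule has_derivative_compose[of "\<lambda>y. y + h *\<^sub>R v" "\<lambda>w. w", OF _ D])
        (use W[of s h] that h in \<open>auto intro!: derivative_eq_intros\<close>)
    show "(F has_derivative ?D (x + s *\<^sub>R u)) (at (x + s *\<^sub>R u))"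
      using D W[of s 0] that h by simp
  qed
  obtain s where s: "0 < s" "s < h" and
    eq: "F (x + h *\<^sub>R u + h *\<^sub>R v) - F (x + h *\<^sub>R u) - (F (x + h *\<^sub>R v) - F x) =
      h * (?D (x + s *\<^sub>R u + h *\<^sub>R v) u - ?D (x + s *\<^sub>R u) u)"
    using line_mean_value[OF h, where f = "\<lambda>y. F (y + h *\<^sub>R v) - F y" and
        f' = "\<lambda>y w. ?D (y + h *\<^sub>R v) w - ?D y w" and a = x and u = u] 1 by auto
  \<comment> \<open>Then direction v, applied to the derivative of \<open>F\<close> along u.\<close>
  have "\<exists>t. 0 < t \<and> t < h \<and> ?D (x + s *\<^sub>R u + h *\<^sub>R v) u - ?D (x + s *\<^sub>R u) u =
      h * frechet_derivative (\<lambda>y. ?D y u) (at (x + s *\<^sub>R u + t *\<^sub>R v)) v"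
    using W s
    by (intro line_mean_value[OF h, where f = "\<lambda>y. ?D y u"
        and f' = "\<lambda>y. frechet_derivative (\<lambda>y. ?D y u) (at y)"]
        smooth_on_imp_has_derivative[OF smooth_on_frechet_derivative[OF F]]) auto
  then obtain t where "0 < t" "t < h" and "?D (x + s *\<^sub>R u + h *\<^sub>R v) u - ?D (x + s *\<^sub>R u) u =
      h * frechet_derivative (\<lambda>y. ?D y u) (at (x + s *\<^sub>R u + t *\<^sub>R v)) v"
    by blast
  then show ?thesis using s eq by (intro exI[of _ s] exI[of _ t]) (simp add: algebra_simps)
qed

text \<open>If the mixed derivatives differed at x by 2e, continuity would keep each within e of its
  value at x on a small ball. A second difference taken inside that ball equals \<open>h * h\<close>
  times a value of either one, so these values coincide, a contradiction.\<close>

lemma symmetric_second_derivative: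
  fixes F :: "'a::euclidean_space \<Rightarrow> real"
  assumes "open W" "smooth_on W F" "x \<in> W"
  shows "frechet_derivative (\<lambda>y. frechet_derivative F (at y) u) (at x) v =
    frechet_derivative (\<lambda>y. frechet_derivative F (at y) v) (at x) u"
proof (rule ccontr)
  define P where "P a b y = frechet_derivative (\<lambda>y. frechet_derivative F (at y) a) (at y) b" for a b y
  assume "\<not> ?thesis"
  then have ne: "P u v x \<noteq> P v u x" by (simp add: P_def)
  define e where "e = \<bar>P u v x - P v u x\<bar> / 2"
  have "e > 0" using ne by (simp add: e_def)
  have cont: "isCont (P a b) x" for a b
    unfolding P_def using smooth_on_imp_continuous_on[OF smooth_on_frechet_derivative[OF
        smooth_on_frechet_derivative[OF assms(2)]]] assms(1,3) continuous_on_eq_continuous_at by blast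
  have "\<forall>\<^sub>F y in nhds x. dist (P a b y) (P a b x) < e" for a b
    using cont[of a b] \<open>e > 0\<close> unfolding continuous_at eventually_nhds_metric LIM_def
    by (metis dist_self)
  then have "\<forall>\<^sub>F y in nhds x. y \<in> W \<and> dist (P u v y) (P u v x) < e \<and> dist (P v u y) (P v u x) < e"
    using assms(1,3) by (intro eventually_conj eventually_nhds_in_open)
  then obtain d where d: "d > 0" and
    dd: "\<And>y. dist y x < d \<Longrightarrow> y \<in> W \<and> \<bar>P u v y - P u v x\<bar> < e \<and> \<bar>P v u y - P v u x\<bar> < e"
    by (auto simp: eventually_nhds_metric dist_real_def)
  \<comment> \<open>Small enough for the parallelogram spanned by \<open>h u\<close> and
    \<open>h v\<close> at x to lie in the ball of radius d; the summand 1 covers u = v = 0.\<close>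
  define h where "h = d / (2 * (norm u + norm v + 1))"
  have pos: "norm u + norm v + 1 > 0" by (smt (verit) norm_ge_zero)
  then have h: "h > 0" using d by (simp add: h_def)
  have "h * (norm u + norm v) < h * (2 * (norm u + norm v + 1))"
    using h pos by (intro mult_strict_left_mono) (auto intro: add_nonneg_nonneg)
  also have "\<dots> = d" using pos by (simp add: h_def)
  finally have hd: "h * (norm u + norm v) < d" .
  have near: "dist (x + s *\<^sub>R a + t *\<^sub>R b) x < d"
    if "0 \<le> s" "s \<le> h" "0 \<le> t" "t \<le> h" "(a, b) = (u, v) \<or> (a, b) = (v, u)" for s t a b
  proof -
    have "dist (x + s *\<^sub>R a + t *\<^sub>R b) x = norm (s *\<^sub>R a + t *\<^sub>R b)"
      by (simp add: dist_norm add.assoc)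
    also have "\<dots> \<le> s * norm a + t * norm b"
      using norm_triangle_ineq[of "s *\<^sub>R a" "t *\<^sub>R b"] that by simp
    also have "\<dots> \<le> h * norm a + h * norm b"
      using that by (intro add_mono mult_right_mono) auto
    also have "\<dots> = h * (norm u + norm v)"
      using that by (auto simp: algebra_simps)
    finally show ?thesis using hd by simp
  qed
  obtain s t where st: "0 < s" "s < h" "0 < t" "t < h" and
    1: "F (x + h *\<^sub>R u + h *\<^sub>R v) - F (x + h *\<^sub>R u) - F (x + h *\<^sub>R v) + F x =
      h * h * P u v (x + s *\<^sub>R u + t *\<^sub>R v)"
    using second_difference[OF h assms(2), of x u v] near dd unfolding P_def by blast
  obtain s' t' where st': "0 < s'" "s' < h" "0 < t'" "t' < h" and
    2: "F (x + h *\<^sub>R v + h *\<^sub>R u) - F (x + h *\<^sub>R v) - F (x + h *\<^sub>R u) + F x =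
      h * h * P v u (x + s' *\<^sub>R v + t' *\<^sub>R u)"
    using second_difference[OF h assms(2), of x v u] near dd unfolding P_def by blast
  \<comment> \<open>The second difference is symmetric in u and v, so its two evaluations
    agree.\<close>
  have comm: "x + h *\<^sub>R v + h *\<^sub>R u = x + h *\<^sub>R u + h *\<^sub>R v"
    by (simp add: add_ac)
  have "h * h * P u v (x + s *\<^sub>R u + t *\<^sub>R v) = h * h * P v u (x + s' *\<^sub>R v + t' *\<^sub>R u)"
    using 1 2[unfolded comm] by linarith
  then have "P u v (x + s *\<^sub>R u + t *\<^sub>R v) = P v u (x + s' *\<^sub>R v + t' *\<^sub>R u)"
    using h by simp
  moreover have "\<bar>P u v (x + s *\<^sub>R u + t *\<^sub>R v) - P u v x\<bar> < e"
    using dd near st by simp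
  moreover have "\<bar>P v u (x + s' *\<^sub>R v + t' *\<^sub>R u) - P v u x\<bar> < e"
    using dd near st' by simp
  ultimately show False unfolding e_def by (simp add: abs_if split: if_splits)
qed

section \<open>Coframes of \<open>\<real>\<^sup>3\<close>\<close>

text \<open>The map \<open>L\<close> with components \<open>a i\<close> is onto: otherwise its range
  lies in a hyperplane, whose normal y is a nontrivial linear relation among the \<open>a i\<close>.
  Hence \<open>L\<close> is also injective, and the preimages of the standard basis vectors form the
  dual basis.\<close>

lemma dual_basis:
  fixes a :: "3 \<Rightarrow> real^3 \<Rightarrow> real"
  assumes lin: "\<And>i. linear (a i)"
    and indep: "\<And>b. (\<And>v. (\<Sum>i\<in>UNIV. b i * a i v) = 0) \<Longrightarrow> \<forall>i. b i = 0"
  shows "\<exists>e. (\<forall>i j. a i (e j) = (if i = j then 1 else 0)) \<and> (\<forall>v. v = (\<Sum>i\<in>UNIV. a i v *\<^sub>R e i))"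
proof -
  define L where "L v = (\<chi> i. a i v)" for v
  have L: "linear L"
    by (rule linearI) (simp_all add: L_def vec_eq_iff linear_add[OF lin] linear_cmul[OF lin])
  have "surj L"
  proof (rule ccontr)
    assume "\<not> surj L"
    moreover have "span (range L) = range L"
      using L by (metis linear_span_image span_UNIV)
    ultimately have "span (range L) \<noteq> UNIV" by metis
    then obtain y where y: "y \<noteq> 0" "span (range L) \<subseteq> {x. y \<bullet> x = 0}"
      using span_not_univ_subset_hyperplane by metis
    have "y \<bullet> L v = 0" for v
      using y(2) span_base[of "L v" "range L"] by blast
    then have "(\<Sum>i\<in>UNIV. y $ i * a i v) = 0" for v
      by (simp add: inner_vec_def L_def)
    then have "\<forall>i. y $ i = 0" by (rule indep)
    then show False using y(1) by (simp add: vec_eq_iff)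
  qed
  then have "inj L" using linear_surjective_imp_injective[OF L] by blast
  define e where "e j = inv L (axis j 1)" for j
  have Le: "L (e j) = axis j 1" for j
    using \<open>surj L\<close> by (simp add: e_def surj_f_inv_f)
  have ae: "a i (e j) = (if i = j then 1 else 0)" for i j
    using arg_cong[OF Le[of j], of "\<lambda>v. v $ i"] by (simp add: L_def axis_def)
  have "L (\<Sum>i\<in>UNIV. a i v *\<^sub>R e i) = L v" for v
    by (simp add: linear_sum[OF L] linear_cmul[OF L] Le) (simp add: L_def vec_eq_iff axis_def if_distrib cong: if_cong)
  then have "v = (\<Sum>i\<in>UNIV. a i v *\<^sub>R e i)" for v
    using \<open>inj L\<close> by (metis injD)
  with ae show ?thesis by blast
qed

text \<open>The matrix whose columns are the dual basis vectors is a right inverse.\<close>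

lemma coframe_det_nonzero:
  fixes a :: "3 \<Rightarrow> real^3 \<Rightarrow> real"
  assumes lin: "\<And>i. linear (a i)"
    and indep: "\<And>b. (\<And>v. (\<Sum>i\<in>UNIV. b i * a i v) = 0) \<Longrightarrow> \<forall>i. b i = 0"
  shows "det (\<chi> i j. a i (axis j 1)) \<noteq> 0"
proof -
  obtain e where e: "\<forall>i j. a i (e j) = (if i = j then 1 else 0)"
    using dual_basis[of a, OF lin indep] by blast
  have expand: "a i w = (\<Sum>k\<in>UNIV. a i (axis k 1) * w $ k)" for i w
  proof -
    have "a i w = a i (\<Sum>k\<in>UNIV. w $ k *\<^sub>R axis k 1)"
      using basis_expansion[of w] by (simp add: scalar_mult_eq_scaleR)
    then show ?thesis using lin[of i] by (simp add: linear_sum linear_cmul mult.commute)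
  qed
  have "(\<chi> i j. a i (axis j 1)) ** (\<chi> i j. e j $ i) = mat 1"
    unfolding matrix_matrix_mult_def mat_def vec_eq_iff
    by (simp only: vec_lambda_beta expand[symmetric] e) simp
  then show ?thesis
    by (metis invertible_det_nz invertible_right_inverse)
qed

lemma matrix_inv_eqI:
  fixes M :: "'a::field^'n^'n"
  assumes "M ** N = mat 1"
  shows "matrix_inv M = N"
proof -
  have N: "N ** M = mat 1" using assms matrix_left_right_inverse by blast
  have "M ** matrix_inv M = mat 1"
    unfolding matrix_inv_def by (rule someI2[of _ N]) (use assms N in auto)
  then show ?thesis by (metis N matrix_mul_assoc matrix_mul_lid matrix_mul_rid)
qed

section \<open>Exterior derivatives on open subsets of a 3-manifold\<close>

text \<open>The open set is a parameter because the calculus is needed both on the domain of the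
  normal form and on smaller neighbourhoods carrying local lifts of an angle.\<close>

locale open_in_manifold3 =
  fixes A :: "('m::{t2_space,second_countable_topology}) chart set" and U :: "'m set"
  assumes manifold: "manifold3 A" and open_U: "open U"
begin

lemma chart_inv_chart: "c \<in> A \<Longrightarrow> p \<in> fst c \<Longrightarrow> chart_inv c (snd c p) = p"
  using manifold unfolding manifold3_def by (meson homeomorphism_apply1)

lemma chart_inv_in: "c \<in> A \<Longrightarrow> x \<in> snd c ` (fst c \<inter> V) \<Longrightarrow> chart_inv c x \<in> V"
  by (auto simp: chart_inv_chart)

lemma in_some_chart: obtains c where "c \<in> A" "p \<in> fst c"
  using manifold unfolding manifold3_def by blast

lemma open_chart_image:
  assumes "c \<in> A" "open V"
  shows "open (snd c ` (fst c \<inter> V))"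
proof -
  have "open (snd c ` fst c)" and "homeomorphism (fst c) (snd c ` fst c) (snd c) (chart_inv c)"
    using manifold assms(1) unfolding manifold3_def by blast+
  then show ?thesis
    using homeomorphism_imp_open_map[of "fst c" "snd c ` fst c" "snd c" "chart_inv c" "fst c \<inter> V"]
      assms(2) openin_open_eq by (metis openin_open_Int)
qed

lemma open_overlap:
  assumes "c \<in> A" "c' \<in> A"
  shows "open (snd c ` (fst c \<inter> fst c'))"
    and "open (snd c ` (fst c \<inter> fst c' \<inter> U))"
proof -
  have "open (fst c')" using manifold assms unfolding manifold3_def by blast
  then show "open (snd c ` (fst c \<inter> fst c'))" "open (snd c ` (fst c \<inter> fst c' \<inter> U))"
    using open_chart_image[OF assms(1)] open_U by (simp_all add: Int_assoc open_Int)
qed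

lemma chart_coordI: "p \<in> fst c \<inter> U \<Longrightarrow> snd c p \<in> snd c ` (fst c \<inter> U)"
  by blast

lemmas open_coords = open_chart_image[OF _ open_U]

lemma smooth_funD: "smooth_fun A U f \<Longrightarrow> c \<in> A \<Longrightarrow> smooth_on (snd c ` (fst c \<inter> U)) (\<lambda>x. f (chart_inv c x))"
  by (simp add: smooth_fun_def o_def)

text \<open>Each chart may use its own representative \<open>F c\<close>. This serves for
  coefficients written as quotients of chart-dependent quantities.\<close>

lemma smooth_funI:
  assumes "\<And>c. c \<in> A \<Longrightarrow> smooth_on (snd c ` (fst c \<inter> U)) (\<lambda>x. F c (chart_inv c x))"
    and "\<And>c p. c \<in> A \<Longrightarrow> p \<in> fst c \<Longrightarrow> p \<in> U \<Longrightarrow> f p = F c p"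
  shows "smooth_fun A U f"
  unfolding smooth_fun_def o_def
proof
  fix c assume c: "c \<in> A"
  show "smooth_on (snd c ` (fst c \<inter> U)) (\<lambda>x. f (chart_inv c x))"
    by (rule smooth_on_cong[OF open_coords[OF c] assms(1)[OF c]])
      (use assms(2)[OF c] c in \<open>auto simp: chart_inv_chart\<close>)
qed

lemma smooth_fun_const: "smooth_fun A U (\<lambda>p. k)"
  by (simp add: smooth_fun_def o_def smooth_on_const open_coords)

lemma smooth_fun_add: "smooth_fun A U f \<Longrightarrow> smooth_fun A U g \<Longrightarrow> smooth_fun A U (\<lambda>p. f p + g p)"
  by (simp add: smooth_fun_def o_def smooth_on_add open_coords)

lemma smooth_fun_diff: "smooth_fun A U f \<Longrightarrow> smooth_fun A U g \<Longrightarrow> smooth_fun A U (\<lambda>p. f p - g p)"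
  by (simp add: smooth_fun_def o_def smooth_on_diff open_coords)

lemma smooth_fun_minus: "smooth_fun A U f \<Longrightarrow> smooth_fun A U (\<lambda>p. - f p)"
  by (simp add: smooth_fun_def o_def smooth_on_minus open_coords)

lemma smooth_fun_mult: "smooth_fun A U f \<Longrightarrow> smooth_fun A U g \<Longrightarrow> smooth_fun A U (\<lambda>p. f p * g p)"
  by (simp add: smooth_fun_def o_def smooth_on_mult open_coords)

lemma smooth_fun_divide:
  "smooth_fun A U f \<Longrightarrow> smooth_fun A U g \<Longrightarrow> (\<And>p. p \<in> U \<Longrightarrow> g p \<noteq> 0) \<Longrightarrow> smooth_fun A U (\<lambda>p. f p / g p)"
  by (simp add: smooth_fun_def o_def smooth_on_divide open_coords chart_inv_in)

lemma smooth_fun_sqrt: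
  "smooth_fun A U f \<Longrightarrow> (\<And>p. p \<in> U \<Longrightarrow> f p > 0) \<Longrightarrow> smooth_fun A U (\<lambda>p. sqrt (f p))"
  by (simp add: smooth_fun_def o_def smooth_on_sqrt open_coords chart_inv_in)

lemma smooth_fun_arctan: "smooth_fun A U f \<Longrightarrow> smooth_fun A U (\<lambda>p. arctan (f p))"
  by (simp add: smooth_fun_def o_def smooth_on_arctan open_coords)

lemmas smooth_fun_intros = smooth_fun_const smooth_fun_add smooth_fun_diff smooth_fun_minus
  smooth_fun_mult smooth_fun_divide smooth_fun_sqrt smooth_fun_arctan

lemma smooth_fun_imp_continuous_on:
  assumes "smooth_fun A U f"
  shows "continuous_on U f"
proof -
  have "isCont f p" if "p \<in> U" for p
  proof -
    obtain c where c: "c \<in> A" "p \<in> fst c" by (rule in_some_chart)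
    have "continuous_on (fst c) (snd c)" and op: "open (fst c)"
      using manifold c unfolding manifold3_def homeomorphism_def by blast+
    moreover have "continuous_on (snd c ` (fst c \<inter> U)) (\<lambda>x. f (chart_inv c x))"
      by (rule smooth_on_imp_continuous_on[OF smooth_funD[OF assms c(1)]])
    ultimately have "continuous_on (fst c \<inter> U) (\<lambda>q. f (chart_inv c (snd c q)))"
      by (intro continuous_on_compose2[of _ "\<lambda>x. f (chart_inv c x)" _ "snd c"])
        (auto intro: continuous_on_subset)
    then have "continuous_on (fst c \<inter> U) f"
      by (rule continuous_on_eq) (simp add: chart_inv_chart c)
    then show "isCont f p"
      using op open_U c that by (simp add: continuous_on_eq_continuous_at open_Int)
  qed
  then show ?thesis by (simp add: continuous_at_imp_continuous_on)
qed

section \<open>Rules for \<open>d0\<close> and \<open>d1\<close>\<close>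

lemma has_derivative_d0:
  assumes "smooth_fun A U f" "c \<in> A" "p \<in> fst c \<inter> U"
  shows "((\<lambda>x. f (chart_inv c x)) has_derivative d0 f c p) (at (snd c p))"
  unfolding d0_def o_def
  using smooth_on_imp_has_derivative[OF smooth_funD[OF assms(1,2)] chart_coordI[OF assms(3)]]
  by simp

lemma d0_eqI: "((\<lambda>x. f (chart_inv c x)) has_derivative D) (at (snd c p)) \<Longrightarrow> d0 f c p = D"
  unfolding d0_def o_def using frechet_derivative_at by fastforce

text \<open>The chart image of \<open>U\<close> is open, so the derivative is determined by the
  values at points \<open>snd c q\<close>, where \<open>chart_inv c\<close> undoes the
  chart.\<close>

lemma has_derivative_coords_cong:
  assumes "(F has_derivative D) (at (snd c p))" "c \<in> A" "p \<in> fst c \<inter> U"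
    and "\<And>q. q \<in> fst c \<inter> U \<Longrightarrow> F (snd c q) = G (snd c q)"
  shows "(G has_derivative D) (at (snd c p))"
  by (rule has_derivative_transform_within_open[OF assms(1) open_coords[OF assms(2)] chart_coordI[OF assms(3)]])
    (use assms(4) in auto)

lemma d0_cong:
  assumes "smooth_fun A U f" "\<And>q. q \<in> U \<Longrightarrow> f q = g q" "c \<in> A" "p \<in> fst c \<inter> U"
  shows "d0 g c p = d0 f c p"
  by (rule d0_eqI, rule has_derivative_coords_cong[OF has_derivative_d0[OF assms(1,3,4)] assms(3,4)])
    (use assms in \<open>auto simp: chart_inv_chart\<close>)

lemma d0_add:
  assumes "smooth_fun A U f" "smooth_fun A U g" "c \<in> A" "p \<in> fst c \<inter> U"
  shows "d0 (\<lambda>q. f q + g q) c p u = d0 f c p u + d0 g c p u"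
  using d0_eqI[OF has_derivative_add[OF has_derivative_d0[OF assms(1,3,4)] has_derivative_d0[OF assms(2-4)]]]
  by simp

lemma d0_mult:
  assumes "smooth_fun A U f" "smooth_fun A U g" "c \<in> A" "p \<in> fst c \<inter> U"
  shows "d0 (\<lambda>q. f q * g q) c p u = f p * d0 g c p u + d0 f c p u * g p"
  using d0_eqI[OF has_derivative_mult[OF has_derivative_d0[OF assms(1,3,4)] has_derivative_d0[OF assms(2-4)]]]
    assms(3,4) by (simp add: chart_inv_chart)

lemma has_derivative_one_form:
  assumes "one_form_on A U \<alpha>" "c \<in> A" "p \<in> fst c \<inter> U"
  shows "((\<lambda>x. \<alpha> c (chart_inv c x) v) has_derivative
    frechet_derivative (\<lambda>x. \<alpha> c (chart_inv c x) v) (at (snd c p))) (at (snd c p))"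
  using assms unfolding one_form_on_def
  by (intro smooth_on_imp_has_derivative[of "snd c ` (fst c \<inter> U)"]) auto

lemma d1_eqI:
  assumes "\<And>v. ((\<lambda>x. \<alpha> c (chart_inv c x) v) has_derivative D v) (at (snd c p))"
  shows "d1 \<alpha> c p u v = D v u - D u v"
  unfolding d1_def by (simp only: frechet_derivative_at[OF assms, symmetric])

lemma d1_cong:
  assumes "one_form_on A U \<alpha>" "forms_eq A U \<alpha> \<beta>" "c \<in> A" "p \<in> fst c \<inter> U"
  shows "d1 \<beta> c p u v = d1 \<alpha> c p u v"
  unfolding d1_def[of \<alpha>]
  by (rule d1_eqI, rule has_derivative_coords_cong[OF has_derivative_one_form[OF assms(1,3,4)] assms(3,4)])
    (use assms in \<open>auto simp: chart_inv_chart forms_eq_def\<close>)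

lemma d1_add:
  assumes "one_form_on A U \<alpha>" "one_form_on A U \<beta>" "c \<in> A" "p \<in> fst c \<inter> U"
  shows "d1 (\<lambda>c p v. \<alpha> c p v + \<beta> c p v) c p u v = d1 \<alpha> c p u v + d1 \<beta> c p u v"
  using d1_eqI[where \<alpha> = "\<lambda>c p v. \<alpha> c p v + \<beta> c p v", OF has_derivative_add[OF
      has_derivative_one_form[OF assms(1,3,4)] has_derivative_one_form[OF assms(2-4)]]]
  by (simp add: d1_def)

lemma d1_scale:
  assumes "smooth_fun A U f" "one_form_on A U \<alpha>" "c \<in> A" "p \<in> fst c \<inter> U"
  shows "d1 (\<lambda>c p v. f p * \<alpha> c p v) c p u v =
    d0 f c p u * \<alpha> c p v - d0 f c p v * \<alpha> c p u + f p * d1 \<alpha> c p u v"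
  using d1_eqI[where \<alpha> = "\<lambda>c p v. f p * \<alpha> c p v", OF has_derivative_mult[OF
      has_derivative_d0[OF assms(1,3,4)] has_derivative_one_form[OF assms(2-4)]]] assms(3,4)
  by (simp add: d1_def chart_inv_chart algebra_simps)

lemma one_form_add:
  assumes "one_form_on A U \<alpha>" "one_form_on A U \<beta>"
  shows "one_form_on A U (\<lambda>c p v. \<alpha> c p v + \<beta> c p v)"
  unfolding one_form_on_def
proof (intro conjI ballI allI)
  fix c p assume "c \<in> A" "p \<in> fst c \<inter> U"
  then have "linear (\<alpha> c p)" "linear (\<beta> c p)" using assms unfolding one_form_on_def by blast+
  then show "linear (\<lambda>v. \<alpha> c p v + \<beta> c p v)" by (rule linear_compose_add)
next
  fix c c' p v assume c: "c \<in> A" "c' \<in> A" "p \<in> fst c \<inter> fst c' \<inter> U"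
  let ?T = "frechet_derivative (snd c' \<circ> chart_inv c) (at (snd c p)) v"
  have "\<alpha> c p v = \<alpha> c' p ?T" "\<beta> c p v = \<beta> c' p ?T"
    using assms c unfolding one_form_on_def by blast+
  then show "\<alpha> c p v + \<beta> c p v = \<alpha> c' p ?T + \<beta> c' p ?T" by (rule arg_cong2)
next
  fix c v assume c: "c \<in> A"
  have "smooth_on (snd c ` (fst c \<inter> U)) (\<lambda>x. \<alpha> c (chart_inv c x) v)"
    "smooth_on (snd c ` (fst c \<inter> U)) (\<lambda>x. \<beta> c (chart_inv c x) v)"
    using assms c unfolding one_form_on_def by blast+
  then show "smooth_on (snd c ` (fst c \<inter> U)) (\<lambda>x. \<alpha> c (chart_inv c x) v + \<beta> c (chart_inv c x) v)"
    by (intro smooth_on_add open_coords c)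
qed

lemma one_form_scale:
  assumes "smooth_fun A U f" "one_form_on A U \<alpha>"
  shows "one_form_on A U (\<lambda>c p v. f p * \<alpha> c p v)"
  unfolding one_form_on_def
proof (intro conjI ballI allI)
  fix c p assume "c \<in> A" "p \<in> fst c \<inter> U"
  then have "linear (\<alpha> c p)" using assms(2) unfolding one_form_on_def by blast
  then show "linear (\<lambda>v. f p * \<alpha> c p v)"
    by (intro linearI) (simp_all add: linear_add linear_cmul algebra_simps)
next
  fix c c' p v assume "c \<in> A" "c' \<in> A" "p \<in> fst c \<inter> fst c' \<inter> U"
  then show "f p * \<alpha> c p v = f p * \<alpha> c' p (frechet_derivative (snd c' \<circ> chart_inv c) (at (snd c p)) v)"
    using assms(2) unfolding one_form_on_def by metis
next
  fix c v assume c: "c \<in> A"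
  then have "smooth_on (snd c ` (fst c \<inter> U)) (\<lambda>x. \<alpha> c (chart_inv c x) v)"
    using assms(2) unfolding one_form_on_def by blast
  then show "smooth_on (snd c ` (fst c \<inter> U)) (\<lambda>x. f (chart_inv c x) * \<alpha> c (chart_inv c x) v)"
    by (intro smooth_on_mult open_coords c smooth_funD[OF assms(1)])
qed

section \<open>Coordinate changes\<close>

definition transition :: "'m chart \<Rightarrow> 'm chart \<Rightarrow> 'm \<Rightarrow> real^3 \<Rightarrow> real^3" where
  "transition c c' p = frechet_derivative (snd c' \<circ> chart_inv c) (at (snd c p))"

lemma smooth_transition:
  "c \<in> A \<Longrightarrow> c' \<in> A \<Longrightarrow> smooth_on (snd c ` (fst c \<inter> fst c')) (snd c' \<circ> chart_inv c)"
  using manifold unfolding manifold3_def by blast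

lemma has_derivative_transition:
  assumes "c \<in> A" "c' \<in> A" "p \<in> fst c \<inter> fst c'"
  shows "((snd c' \<circ> chart_inv c) has_derivative transition c c' p) (at (snd c p))"
  unfolding transition_def
  using smooth_on_imp_has_derivative[OF smooth_transition[OF assms(1,2)]] assms(3) by blast

lemma has_derivative_overlap_cong:
  assumes "(F has_derivative D) (at (snd c p))" "c \<in> A" "c' \<in> A" "p \<in> fst c \<inter> fst c' \<inter> U"
    and "\<And>q. q \<in> fst c \<inter> fst c' \<inter> U \<Longrightarrow> F (snd c q) = G (snd c q)"
  shows "(G has_derivative D) (at (snd c p))"
  by (rule has_derivative_transform_within_open[OF assms(1) open_overlap(2)[OF assms(2,3)]])
    (use assms(4,5) in auto)

lemma one_form_on_d0:
  assumes "smooth_fun A U f"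
  shows "one_form_on A U (d0 f)"
  unfolding one_form_on_def
proof (intro conjI ballI allI)
  fix c p assume "c \<in> A" "p \<in> fst c \<inter> U"
  then show "linear (d0 f c p)"
    using has_derivative_d0[OF assms] has_derivative_linear by blast
next
  fix c c' p v assume c: "c \<in> A" "c' \<in> A" and p: "p \<in> fst c \<inter> fst c' \<inter> U"
  \<comment> \<open>The covector law for \<open>d0 f\<close> is the chain rule: on the overlap this
    composite is the expression of \<open>f\<close> in the chart \<open>c\<close>.\<close>
  have "((\<lambda>x. f (chart_inv c' ((snd c' \<circ> chart_inv c) x))) has_derivative
      (\<lambda>v. d0 f c' p (transition c c' p v))) (at (snd c p))"
  proof (rule has_derivative_compose[of "snd c' \<circ> chart_inv c"])
    show "(snd c' \<circ> chart_inv c has_derivative transition c c' p) (at (snd c p))"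
      using has_derivative_transition c p by blast
    show "((\<lambda>x. f (chart_inv c' x)) has_derivative d0 f c' p) (at ((snd c' \<circ> chart_inv c) (snd c p)))"
      using has_derivative_d0[OF assms c(2), of p] p c by (simp add: chart_inv_chart)
  qed
  then have "((\<lambda>x. f (chart_inv c x)) has_derivative
      (\<lambda>v. d0 f c' p (transition c c' p v))) (at (snd c p))"
    by (rule has_derivative_overlap_cong[OF _ c p]) (use c in \<open>auto simp: chart_inv_chart\<close>)
  then show "d0 f c p v = d0 f c' p (frechet_derivative (snd c' \<circ> chart_inv c) (at (snd c p)) v)"
    using d0_eqI unfolding transition_def by metis
next
  fix c v assume c: "c \<in> A"
  show "smooth_on (snd c ` (fst c \<inter> U)) (\<lambda>x. d0 f c (chart_inv c x) v)"
    by (rule smooth_on_cong[OF open_coords[OF c] smooth_on_frechet_derivative[OF smooth_funD[OF assms c]]])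
      (use c in \<open>auto simp: chart_inv_chart d0_def o_def\<close>)
qed

text \<open>In a chart this is the symmetry of the second derivatives of \<open>f\<close>.\<close>

lemma d1_d0:
  assumes "smooth_fun A U f" "c \<in> A" "p \<in> fst c \<inter> U"
  shows "d1 (d0 f) c p u v = 0"
proof -
  let ?F = "\<lambda>x. f (chart_inv c x)"
  have F: "smooth_on (snd c ` (fst c \<inter> U)) ?F" using smooth_funD assms by blast
  have "((\<lambda>x. d0 f c (chart_inv c x) v) has_derivative
      frechet_derivative (\<lambda>x. frechet_derivative ?F (at x) v) (at (snd c p))) (at (snd c p))" for v
    by (rule has_derivative_coords_cong[OF smooth_on_imp_has_derivative[OF smooth_on_frechet_derivative[OF F]
            chart_coordI[OF assms(3)]] assms(2,3)])
      (use assms(2) in \<open>auto simp: chart_inv_chart d0_def o_def\<close>)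
  then have "d1 (d0 f) c p u v =
      frechet_derivative (\<lambda>x. frechet_derivative ?F (at x) v) (at (snd c p)) u -
      frechet_derivative (\<lambda>x. frechet_derivative ?F (at x) u) (at (snd c p)) v"
    by (rule d1_eqI)
  then show ?thesis
    using symmetric_second_derivative[OF open_coords[OF assms(2)] F chart_coordI[OF assms(3)], of u v]
    by simp
qed

text \<open>Linearity is required in the first slot only; antisymmetry carries it to the
  second.\<close>

definition two_form_on :: "'m form2 \<Rightarrow> bool" where
  "two_form_on B \<longleftrightarrow>
     (\<forall>c\<in>A. \<forall>p\<in>fst c \<inter> U. (\<forall>v. linear (\<lambda>u. B c p u v)) \<and> (\<forall>u v. B c p u v = - B c p v u)) \<and>
     (\<forall>c\<in>A. \<forall>c'\<in>A. \<forall>p\<in>fst c \<inter> fst c' \<inter> U. \<forall>u v.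
        B c p u v = B c' p (transition c c' p u) (transition c c' p v)) \<and>
     (\<forall>c\<in>A. \<forall>u v. smooth_on (snd c ` (fst c \<inter> U)) (\<lambda>x. B c (chart_inv c x) u v))"

lemma one_form_linear: "one_form_on A U \<alpha> \<Longrightarrow> c \<in> A \<Longrightarrow> p \<in> fst c \<inter> U \<Longrightarrow> linear (\<alpha> c p)"
  unfolding one_form_on_def by blast

lemma one_form_smooth:
  "one_form_on A U \<alpha> \<Longrightarrow> c \<in> A \<Longrightarrow> smooth_on (snd c ` (fst c \<inter> U)) (\<lambda>x. \<alpha> c (chart_inv c x) v)"
  unfolding one_form_on_def by blast

lemma one_form_transition:
  "one_form_on A U \<alpha> \<Longrightarrow> c \<in> A \<Longrightarrow> c' \<in> A \<Longrightarrow> p \<in> fst c \<inter> fst c' \<inter> U \<Longrightarrow>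
    \<alpha> c p v = \<alpha> c' p (transition c c' p v)"
  unfolding one_form_on_def transition_def by blast

lemma one_form_expand:
  assumes "one_form_on A U \<alpha>" "c \<in> A" "p \<in> fst c \<inter> U"
  shows "\<alpha> c p v = (\<Sum>i\<in>UNIV. v $ i * \<alpha> c p (axis i 1))"
proof -
  have "\<alpha> c p v = \<alpha> c p (\<Sum>i\<in>UNIV. v $ i *\<^sub>R axis i 1)"
    using basis_expansion[of v] by (simp add: scalar_mult_eq_scaleR)
  then show ?thesis
    using one_form_linear[OF assms] by (simp add: linear_sum linear_cmul)
qed

text \<open>The second derivatives of the coordinate change enter symmetrically and cancel.\<close>

lemma d1_transition:
  assumes \<alpha>: "one_form_on A U \<alpha>" and c: "c \<in> A" "c' \<in> A" and p: "p \<in> fst c \<inter> fst c' \<inter> U"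
  shows "d1 \<alpha> c p u v = d1 \<alpha> c' p (transition c c' p u) (transition c c' p v)"
proof -
  let ?\<phi> = "snd c' \<circ> chart_inv c" and ?W = "snd c ` (fst c \<inter> fst c')"
  let ?T = "transition c c' p"
  have pW: "snd c p \<in> ?W" and p': "p \<in> fst c \<inter> U" "p \<in> fst c' \<inter> U" using p by auto
  have \<phi>p: "?\<phi> (snd c p) = snd c' p" using c p by (simp add: chart_inv_chart)
  define a where "a i y = \<alpha> c' (chart_inv c' y) (axis i 1)" for i :: 3 and y
  define Da where "Da i = frechet_derivative (a i) (at (snd c' p))" for i
  have Da: "(a i has_derivative Da i) (at (snd c' p))" for i
    unfolding Da_def a_def using has_derivative_one_form[OF \<alpha> c(2) p'(2)] by simp
  \<comment> \<open>The second derivatives of the coordinate change: \<open>H i v\<close>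
    differentiates the i-th component of the Jacobian applied to v.\<close>
  define H where "H i v = frechet_derivative (\<lambda>x. frechet_derivative (\<lambda>x. ?\<phi> x $ i) (at x) v) (at (snd c p))"
    for i :: 3 and v
  have \<phi>i: "smooth_on ?W (\<lambda>x. ?\<phi> x $ i)" for i
    by (rule smooth_on_bounded_linear[OF open_overlap(1)[OF c] bounded_linear_vec_nth smooth_transition[OF c]])
  have \<phi>i_der: "frechet_derivative ?\<phi> (at x) v $ i = frechet_derivative (\<lambda>x. ?\<phi> x $ i) (at x) v"
    if "x \<in> ?W" for x v i
    using fun_cong[OF frechet_derivative_at[OF bounded_linear.has_derivative[OF bounded_linear_vec_nth
            smooth_on_imp_has_derivative[OF smooth_transition[OF c] that]]], of v] .
  have H: "((\<lambda>x. frechet_derivative (\<lambda>x. ?\<phi> x $ i) (at x) v) has_derivative H i v) (at (snd c p))" for i v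
    unfolding H_def
    by (rule smooth_on_imp_has_derivative[OF smooth_on_frechet_derivative[OF \<phi>i] pW])
  have sym: "H i v u = H i u v" for i u v
    unfolding H_def by (rule symmetric_second_derivative[OF open_overlap(1)[OF c] \<phi>i pW])
  have "((\<lambda>x. \<Sum>i\<in>UNIV. frechet_derivative (\<lambda>x. ?\<phi> x $ i) (at x) v * a i (?\<phi> x)) has_derivative
      (\<lambda>u. \<Sum>i\<in>UNIV. ?T v $ i * Da i (?T u) + H i v u * a i (snd c' p))) (at (snd c p))" for v
  proof (rule has_derivative_sum)
    fix i :: 3
    have "((\<lambda>x. a i (?\<phi> x)) has_derivative (\<lambda>u. Da i (?T u))) (at (snd c p))"
      using has_derivative_compose[of ?\<phi>, OF has_derivative_transition[OF c]] Da \<phi>p p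
      by (metis IntD1)
    from has_derivative_mult[OF H this]
    show "((\<lambda>x. frechet_derivative (\<lambda>x. ?\<phi> x $ i) (at x) v * a i (?\<phi> x)) has_derivative
        (\<lambda>u. ?T v $ i * Da i (?T u) + H i v u * a i (snd c' p))) (at (snd c p))"
      using \<phi>p by (simp add: \<phi>i_der[OF pW] transition_def)
  qed
  then have "((\<lambda>x. \<alpha> c (chart_inv c x) v) has_derivative
      (\<lambda>u. \<Sum>i\<in>UNIV. ?T v $ i * Da i (?T u) + H i v u * a i (snd c' p))) (at (snd c p))" for v
  proof (rule has_derivative_overlap_cong[OF _ c p])
    fix q assume q: "q \<in> fst c \<inter> fst c' \<inter> U"
    have "\<alpha> c q v = \<alpha> c' q (transition c c' q v)"
      using one_form_transition[OF \<alpha> c q] .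
    also have "\<dots> = (\<Sum>i\<in>UNIV. transition c c' q v $ i * \<alpha> c' q (axis i 1))"
      using one_form_expand[OF \<alpha> c(2)] q by blast
    finally show "(\<Sum>i\<in>UNIV. frechet_derivative (\<lambda>x. ?\<phi> x $ i) (at (snd c q)) v * a i (?\<phi> (snd c q)))
        = \<alpha> c (chart_inv c (snd c q)) v"
      using q c \<phi>i_der[of "snd c q"] by (simp add: chart_inv_chart transition_def a_def)
  qed
  then have 1: "d1 \<alpha> c p u v = (\<Sum>i\<in>UNIV. ?T v $ i * Da i (?T u) + H i v u * a i (snd c' p))
      - (\<Sum>i\<in>UNIV. ?T u $ i * Da i (?T v) + H i u v * a i (snd c' p))"
    by (rule d1_eqI)
  have "((\<lambda>y. \<alpha> c' (chart_inv c' y) v) has_derivative (\<lambda>u. \<Sum>i\<in>UNIV. v $ i * Da i u)) (at (snd c' p))" for v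
    by (rule has_derivative_coords_cong[OF has_derivative_sum[OF has_derivative_mult_right[OF Da]] c(2) p'(2)])
      (use c one_form_expand[OF \<alpha> c(2)] in \<open>simp add: a_def chart_inv_chart\<close>)
  then have "d1 \<alpha> c' p (?T u) (?T v) = (\<Sum>i\<in>UNIV. ?T v $ i * Da i (?T u)) - (\<Sum>i\<in>UNIV. ?T u $ i * Da i (?T v))"
    by (rule d1_eqI)
  with 1 show ?thesis by (simp add: sum.distrib sym)
qed

lemma two_form_on_d1:
  assumes \<alpha>: "one_form_on A U \<alpha>"
  shows "two_form_on (d1 \<alpha>)"
  unfolding two_form_on_def
proof (intro conjI ballI allI)
  fix c p v assume c: "c \<in> A" and p: "p \<in> fst c \<inter> U"
  let ?D = "\<lambda>v. frechet_derivative (\<lambda>x. \<alpha> c (chart_inv c x) v) (at (snd c p))"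
  \<comment> \<open>In \<open>d1\<close> the vector u occurs once as direction of differentiation
    and once as argument of the form. The second dependence is linear because differentiation
    preserves the linearity of \<alpha>, which this fact and \<open>D_scale\<close> record.\<close>
  have D_add: "((\<lambda>x. \<alpha> c (chart_inv c x) (u + w)) has_derivative (\<lambda>v. ?D u v + ?D w v)) (at (snd c p))" for u w
    by (rule has_derivative_coords_cong[OF has_derivative_add[OF has_derivative_one_form[OF \<alpha> c p]
            has_derivative_one_form[OF \<alpha> c p]] c p])
      (use c in \<open>simp add: chart_inv_chart linear_add[OF one_form_linear[OF \<alpha>]]\<close>)
  have add: "?D (u + w) v = ?D u v + ?D w v" for u w
    using fun_cong[OF frechet_derivative_at[OF D_add[of u w]], of v] by simp
  have D_scale: "((\<lambda>x. \<alpha> c (chart_inv c x) (r *\<^sub>R w)) has_derivative (\<lambda>v. r * ?D w v)) (at (snd c p))" for r w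
    by (rule has_derivative_coords_cong[OF has_derivative_mult_right[OF has_derivative_one_form[OF \<alpha> c p]] c p])
      (use c in \<open>simp add: chart_inv_chart linear_cmul[OF one_form_linear[OF \<alpha>]]\<close>)
  have scale: "?D (r *\<^sub>R w) v = r * ?D w v" for r w
    using fun_cong[OF frechet_derivative_at[OF D_scale[of r w]], of v] by simp
  have lin: "linear (?D v)"
    using has_derivative_one_form[OF \<alpha> c p] has_derivative_linear by blast
  show "linear (\<lambda>u. d1 \<alpha> c p u v)"
    by (rule linearI) (simp_all add: d1_def add scale linear_add[OF lin] linear_cmul[OF lin] algebra_simps)
next
  fix c p u v
  show "d1 \<alpha> c p u v = - d1 \<alpha> c p v u" by (simp add: d1_def)
next
  fix c c' p u v assume "c \<in> A" "c' \<in> A" "p \<in> fst c \<inter> fst c' \<inter> U"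
  then show "d1 \<alpha> c p u v = d1 \<alpha> c' p (transition c c' p u) (transition c c' p v)"
    by (rule d1_transition[OF \<alpha>])
next
  fix c u v assume c: "c \<in> A"
  have "smooth_on (snd c ` (fst c \<inter> U)) (\<lambda>x. frechet_derivative (\<lambda>x. \<alpha> c (chart_inv c x) v) (at x) u
      - frechet_derivative (\<lambda>x. \<alpha> c (chart_inv c x) u) (at x) v)"
    by (intro smooth_on_diff open_coords c smooth_on_frechet_derivative one_form_smooth[OF \<alpha>])
  then show "smooth_on (snd c ` (fst c \<inter> U)) (\<lambda>x. d1 \<alpha> c (chart_inv c x) u v)"
  proof (rule smooth_on_cong[OF open_coords[OF c]])
    fix x assume "x \<in> snd c ` (fst c \<inter> U)"
    then have "snd c (chart_inv c x) = x" using c by (auto simp: chart_inv_chart)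
    then show "frechet_derivative (\<lambda>x. \<alpha> c (chart_inv c x) v) (at x) u
      - frechet_derivative (\<lambda>x. \<alpha> c (chart_inv c x) u) (at x) v = d1 \<alpha> c (chart_inv c x) u v"
      by (simp only: d1_def)
  qed
qed

end

section \<open>Coefficients with respect to a coframing\<close>

context open_in_manifold3
begin

lemma coframing_one_form: "coframing_on A U \<omega> \<Longrightarrow> one_form_on A U (\<omega> i)"
  by (simp add: coframing_on_def)

lemma coframe_independent:
  assumes "coframing_on A U \<omega>" "c \<in> A" "p \<in> fst c \<inter> U"
    and "\<And>v. x1 * \<omega> 1 c p v + x2 * \<omega> 2 c p v + x3 * \<omega> 3 c p v = 0"
  shows "x1 = 0 \<and> x2 = 0 \<and> x3 = 0"
proof -
  let ?b = "\<lambda>i::3. if i = 1 then x1 else if i = 2 then x2 else x3"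
  have "(\<Sum>i\<in>UNIV. ?b i * \<omega> i c p v) = 0" for v
    using assms(4)[of v] by (simp add: sum_3)
  moreover have indep: "\<forall>b. (\<forall>v. (\<Sum>i\<in>UNIV. b i * \<omega> i c p v) = 0) \<longrightarrow> (\<forall>i. b i = 0)"
    using assms(1-3) unfolding coframing_on_def by blast
  ultimately have "\<forall>i. ?b i = 0" using spec[OF indep, of ?b] by simp
  then show ?thesis by (simp add: forall_3)
qed

lemma dual_frame:
  assumes "coframing_on A U \<omega>" "c \<in> A" "p \<in> fst c \<inter> U"
  shows "\<exists>e. (\<forall>i j. \<omega> i c p (e j) = (if i = j then 1 else 0)) \<and>
    (\<forall>v. v = \<omega> 1 c p v *\<^sub>R e 1 + \<omega> 2 c p v *\<^sub>R e 2 + \<omega> 3 c p v *\<^sub>R e 3)"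
proof -
  have "linear (\<omega> i c p)" for i
    using one_form_linear[OF coframing_one_form[OF assms(1)] assms(2,3)] .
  moreover have "\<forall>i. b i = 0" if "\<And>v. (\<Sum>i\<in>UNIV. b i * \<omega> i c p v) = 0" for b :: "3 \<Rightarrow> real"
    using assms that unfolding coframing_on_def by blast
  ultimately show ?thesis
    using dual_basis[of "\<lambda>i. \<omega> i c p"] unfolding sum_3 by blast
qed

text \<open>On the coordinate vectors the volume form is the determinant of the coframe
  matrix.\<close>

lemma vol_nonzero:
  assumes "coframing_on A U \<omega>" "c \<in> A" "p \<in> fst c \<inter> U"
  shows "vol \<omega> c p (axis 1 1) (axis 2 1) (axis 3 1) \<noteq> 0"
proof -
  have "det (\<chi> i j. \<omega> i c p (axis j 1)) \<noteq> 0"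
  proof (rule coframe_det_nonzero)
    show "linear (\<omega> i c p)" for i
      using one_form_linear[OF coframing_one_form[OF assms(1)] assms(2,3)] .
    show "\<forall>i. b i = 0" if "\<And>v. (\<Sum>i\<in>UNIV. b i * \<omega> i c p v) = 0" for b :: "3 \<Rightarrow> real"
      using assms that unfolding coframing_on_def by blast
  qed
  then show ?thesis
    by (simp add: det_3 vol_def wedge12_def wedge11_def algebra_simps)
qed

text \<open>Evaluation on pairs of dual frame vectors isolates each coefficient.\<close>

lemma coframe2_independent:
  assumes "coframing_on A U \<omega>" "c \<in> A" "p \<in> fst c \<inter> U"
    and "\<And>u v. x12 * wedge11 (\<omega> 1) (\<omega> 2) c p u v + x13 * wedge11 (\<omega> 1) (\<omega> 3) c p u v
      + x23 * wedge11 (\<omega> 2) (\<omega> 3) c p u v = 0"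
  shows "x12 = 0 \<and> x13 = 0 \<and> x23 = 0"
proof -
  obtain e where e: "\<forall>i j. \<omega> i c p (e j) = (if i = j then 1 else 0)"
    using dual_frame[OF assms(1-3)] by blast
  show ?thesis
    using assms(4)[of "e 1" "e 2"] assms(4)[of "e 1" "e 3"] assms(4)[of "e 2" "e 3"]
    by (simp add: wedge11_def e)
qed

lemma smooth_wedge11:
  assumes "c \<in> A" "one_form_on A U \<alpha>" "one_form_on A U \<beta>"
  shows "smooth_on (snd c ` (fst c \<inter> U)) (\<lambda>x. wedge11 \<alpha> \<beta> c (chart_inv c x) u v)"
  unfolding wedge11_def
  by (intro smooth_on_diff smooth_on_mult open_coords one_form_smooth[OF _ assms(1)] assms)

lemma smooth_wedge12:
  assumes "c \<in> A" "one_form_on A U \<alpha>"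
    and "\<And>u v. smooth_on (snd c ` (fst c \<inter> U)) (\<lambda>x. B c (chart_inv c x) u v)"
  shows "smooth_on (snd c ` (fst c \<inter> U)) (\<lambda>x. wedge12 \<alpha> B c (chart_inv c x) u v w)"
  unfolding wedge12_def
  by (intro smooth_on_diff smooth_on_add smooth_on_mult open_coords[OF assms(1)]
      one_form_smooth[OF assms(2,1)] assms(3))

text \<open>In each chart \<open>f\<close> is the quotient of two smooth functions, the values of
  \<open>T\<close> and \<open>vol \<omega>\<close> on the coordinate vectors, and the denominator
  never vanishes.\<close>

lemma smooth_fun_vol_ratio:
  assumes "coframing_on A U \<omega>"
    and "\<And>c. c \<in> A \<Longrightarrow> smooth_on (snd c ` (fst c \<inter> U))
      (\<lambda>x. T c (chart_inv c x) (axis 1 1) (axis 2 1) (axis 3 1))"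
    and "\<And>c p. c \<in> A \<Longrightarrow> p \<in> fst c \<Longrightarrow> p \<in> U \<Longrightarrow>
      T c p (axis 1 1) (axis 2 1) (axis 3 1) = f p * vol \<omega> c p (axis 1 1) (axis 2 1) (axis 3 1)"
  shows "smooth_fun A U f"
proof (rule smooth_funI)
  fix c assume c: "c \<in> A"
  show "smooth_on (snd c ` (fst c \<inter> U)) (\<lambda>x. T c (chart_inv c x) (axis 1 1) (axis 2 1) (axis 3 1)
      / vol \<omega> c (chart_inv c x) (axis 1 1) (axis 2 1) (axis 3 1))"
  proof (rule smooth_on_divide[OF open_coords[OF c] assms(2)[OF c]])
    show "smooth_on (snd c ` (fst c \<inter> U)) (\<lambda>x. vol \<omega> c (chart_inv c x) (axis 1 1) (axis 2 1) (axis 3 1))"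
      unfolding vol_def
      by (intro smooth_wedge12 smooth_wedge11 coframing_one_form assms(1) c)
    fix x assume "x \<in> snd c ` (fst c \<inter> U)"
    then have "chart_inv c x \<in> fst c \<inter> U" using c by (auto simp: chart_inv_chart)
    then show "vol \<omega> c (chart_inv c x) (axis 1 1) (axis 2 1) (axis 3 1) \<noteq> 0"
      using vol_nonzero[OF assms(1) c] by blast
  qed
next
  fix c p assume "c \<in> A" "p \<in> fst c" "p \<in> U"
  then show "f p = T c p (axis 1 1) (axis 2 1) (axis 3 1) / vol \<omega> c p (axis 1 1) (axis 2 1) (axis 3 1)"
    using assms(3) vol_nonzero[OF assms(1)] by simp
qed

text \<open>Cramer's rule: putting \<alpha> in place of \<open>\<omega> i\<close> in the volume form
  multiplies it by the i-th coefficient.\<close>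

lemma coefficients1_smooth:
  assumes \<omega>: "coframing_on A U \<omega>" and \<alpha>: "one_form_on A U \<alpha>"
    and eq: "forms_eq A U \<alpha> (comb1 \<omega> f1 f2 f3)"
  shows "smooth_fun A U f1" "smooth_fun A U f2" "smooth_fun A U f3"
proof -
  note intros = smooth_wedge12 smooth_wedge11 coframing_one_form \<omega> \<alpha>
  have eq': "\<alpha> c p v = f1 p * \<omega> 1 c p v + f2 p * \<omega> 2 c p v + f3 p * \<omega> 3 c p v"
    if "c \<in> A" "p \<in> fst c" "p \<in> U" for c p v
    using eq that by (simp add: forms_eq_def comb1_def)
  show "smooth_fun A U f1"
    by (rule smooth_fun_vol_ratio[OF \<omega>, of "wedge12 \<alpha> (wedge11 (\<omega> 2) (\<omega> 3))"])
      (auto intro!: intros, simp add: eq' vol_def wedge12_def wedge11_def algebra_simps)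
  show "smooth_fun A U f2"
    by (rule smooth_fun_vol_ratio[OF \<omega>, of "wedge12 (\<omega> 1) (wedge11 \<alpha> (\<omega> 3))"])
      (auto intro!: intros, simp add: eq' vol_def wedge12_def wedge11_def algebra_simps)
  show "smooth_fun A U f3"
    by (rule smooth_fun_vol_ratio[OF \<omega>, of "wedge12 (\<omega> 1) (wedge11 (\<omega> 2) \<alpha>)"])
      (auto intro!: intros, simp add: eq' vol_def wedge12_def wedge11_def algebra_simps)
qed

text \<open>Wedging with one coframe form kills the two basis 2-forms that contain it and isolates
  the third coefficient.\<close>

lemma coefficients2_smooth:
  assumes \<omega>: "coframing_on A U \<omega>" and B: "two_form_on B"
    and eq: "forms_eq A U B (comb2 \<omega> f12 f13 f23)"
  shows "smooth_fun A U f12" "smooth_fun A U f13" "smooth_fun A U f23"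
proof -
  have B': "smooth_on (snd c ` (fst c \<inter> U)) (\<lambda>x. B c (chart_inv c x) u v)" if "c \<in> A" for c u v
    using B that unfolding two_form_on_def by blast
  note intros = smooth_wedge12 coframing_one_form \<omega> B'
  have eq': "B c p u v = f12 p * wedge11 (\<omega> 1) (\<omega> 2) c p u v
      + f13 p * wedge11 (\<omega> 1) (\<omega> 3) c p u v + f23 p * wedge11 (\<omega> 2) (\<omega> 3) c p u v"
    if "c \<in> A" "p \<in> fst c" "p \<in> U" for c p u v
    using eq that by (simp add: forms_eq_def comb2_def)
  show "smooth_fun A U f12"
    by (rule smooth_fun_vol_ratio[OF \<omega>, of "wedge12 (\<omega> 3) B"])
      (auto intro!: intros, simp add: eq' vol_def wedge12_def wedge11_def algebra_simps)
  \<comment> \<open>The sign comes from reordering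
    \<open>\<omega> 2 \<and> \<omega> 1 \<and> \<omega> 3\<close> into the volume form.\<close>
  have "smooth_fun A U (\<lambda>p. - f13 p)"
    by (rule smooth_fun_vol_ratio[OF \<omega>, of "wedge12 (\<omega> 2) B"])
      (auto intro!: intros, simp add: eq' vol_def wedge12_def wedge11_def algebra_simps)
  then show "smooth_fun A U f13" using smooth_fun_minus by fastforce
  show "smooth_fun A U f23"
    by (rule smooth_fun_vol_ratio[OF \<omega>, of "wedge12 (\<omega> 1) B"])
      (auto intro!: intros, simp add: eq' vol_def wedge12_def wedge11_def algebra_simps)
qed

text \<open>At each point the coefficients are read off from the dual frame in one chart; the
  transformation laws make the same numbers valid in every chart. The functions are thus chosen
  pointwise, and their smoothness follows afterwards from Cramer's rule.\<close>

lemma coefficients1: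
  assumes \<omega>: "coframing_on A U \<omega>" and \<alpha>: "one_form_on A U \<alpha>"
  obtains f1 f2 f3 where "smooth_fun A U f1" "smooth_fun A U f2" "smooth_fun A U f3"
    and "forms_eq A U \<alpha> (comb1 \<omega> f1 f2 f3)"
proof -
  have "\<exists>x1 x2 x3. \<forall>c\<in>A. p \<in> fst c \<longrightarrow>
      (\<forall>v. \<alpha> c p v = x1 * \<omega> 1 c p v + x2 * \<omega> 2 c p v + x3 * \<omega> 3 c p v)" if p: "p \<in> U" for p
  proof -
    obtain c' where c': "c' \<in> A" "p \<in> fst c'" by (rule in_some_chart)
    then have "p \<in> fst c' \<inter> U" using p by blast
    then obtain e :: "3 \<Rightarrow> real^3" where "\<forall>v. v = \<omega> 1 c' p v *\<^sub>R e 1 + \<omega> 2 c' p v *\<^sub>R e 2 + \<omega> 3 c' p v *\<^sub>R e 3"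
      using dual_frame[OF \<omega> c'(1)] by blast
    then have e: "v = \<omega> 1 c' p v *\<^sub>R e 1 + \<omega> 2 c' p v *\<^sub>R e 2 + \<omega> 3 c' p v *\<^sub>R e 3" for v
      by blast
    have lin: "linear (\<alpha> c' p)" using one_form_linear[OF \<alpha> c'(1)] c' p by blast
    have eq: "\<alpha> c' p v = \<alpha> c' p (e 1) * \<omega> 1 c' p v + \<alpha> c' p (e 2) * \<omega> 2 c' p v
        + \<alpha> c' p (e 3) * \<omega> 3 c' p v" for v
      using arg_cong[OF e[of v], of "\<alpha> c' p"] by (simp add: linear_add[OF lin] linear_cmul[OF lin])
    have "\<alpha> c p v = \<alpha> c' p (e 1) * \<omega> 1 c p v + \<alpha> c' p (e 2) * \<omega> 2 c p v
        + \<alpha> c' p (e 3) * \<omega> 3 c p v" if c: "c \<in> A" "p \<in> fst c" for c v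
      using one_form_transition[OF \<alpha> c(1) c'(1), of p v] eq[of "transition c c' p v"]
        one_form_transition[OF coframing_one_form[OF \<omega>] c(1) c'(1), of p _ v] c c' p by simp
    then show ?thesis by blast
  qed
  then obtain f1 f2 f3 where f: "\<And>p c v. \<lbrakk>p \<in> U; c \<in> A; p \<in> fst c\<rbrakk> \<Longrightarrow>
      \<alpha> c p v = f1 p * \<omega> 1 c p v + f2 p * \<omega> 2 c p v + f3 p * \<omega> 3 c p v"
    by metis
  then have "forms_eq A U \<alpha> (comb1 \<omega> f1 f2 f3)"
    by (simp add: forms_eq_def comb1_def fun_eq_iff)
  with coefficients1_smooth[OF \<omega> \<alpha> this] that show thesis by blast
qed

text \<open>As for 1-forms, with the coefficients given by the values of \<open>B\<close> on pairs
  of dual frame vectors.\<close>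

lemma coefficients2:
  assumes \<omega>: "coframing_on A U \<omega>" and B: "two_form_on B"
  obtains f12 f13 f23 where "smooth_fun A U f12" "smooth_fun A U f13" "smooth_fun A U f23"
    and "forms_eq A U B (comb2 \<omega> f12 f13 f23)"
proof -
  have "\<exists>x12 x13 x23. \<forall>c\<in>A. p \<in> fst c \<longrightarrow>
      (\<forall>u v. B c p u v = x12 * wedge11 (\<omega> 1) (\<omega> 2) c p u v + x13 * wedge11 (\<omega> 1) (\<omega> 3) c p u v
        + x23 * wedge11 (\<omega> 2) (\<omega> 3) c p u v)" if p: "p \<in> U" for p
  proof -
    obtain c' where c': "c' \<in> A" "p \<in> fst c'" by (rule in_some_chart)
    then have "p \<in> fst c' \<inter> U" using p by blast
    then obtain e :: "3 \<Rightarrow> real^3" where "\<forall>v. v = \<omega> 1 c' p v *\<^sub>R e 1 + \<omega> 2 c' p v *\<^sub>R e 2 + \<omega> 3 c' p v *\<^sub>R e 3"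
      using dual_frame[OF \<omega> c'(1)] by blast
    then have e: "v = \<omega> 1 c' p v *\<^sub>R e 1 + \<omega> 2 c' p v *\<^sub>R e 2 + \<omega> 3 c' p v *\<^sub>R e 3" for v
      by blast
    have lin: "linear (\<lambda>u. B c' p u v)" and alt: "B c' p u v = - B c' p v u" for u v
      using B c' p unfolding two_form_on_def by blast+
    have left: "B c' p u v = \<omega> 1 c' p u * B c' p (e 1) v + \<omega> 2 c' p u * B c' p (e 2) v
        + \<omega> 3 c' p u * B c' p (e 3) v" for u v
      using arg_cong[OF e[of u], of "\<lambda>u. B c' p u v"]
      by (simp add: linear_add[OF lin] linear_cmul[OF lin])
    \<comment> \<open>The second slot is expanded by swapping it into the first.\<close>
    have right: "B c' p (e i) v = - (\<omega> 1 c' p v * B c' p (e 1) (e i) + \<omega> 2 c' p v * B c' p (e 2) (e i)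
        + \<omega> 3 c' p v * B c' p (e 3) (e i))" for i v
      using alt left[of v "e i"] by metis
    have z: "B c' p (e i) (e i) = 0" for i using alt[of "e i" "e i"] by simp
    have eq: "B c' p u v = B c' p (e 1) (e 2) * wedge11 (\<omega> 1) (\<omega> 2) c' p u v
        + B c' p (e 1) (e 3) * wedge11 (\<omega> 1) (\<omega> 3) c' p u v
        + B c' p (e 2) (e 3) * wedge11 (\<omega> 2) (\<omega> 3) c' p u v" for u v
      unfolding left[of u v] right[of _ v] z wedge11_def
      by (simp add: alt[of "e 2" "e 1"] alt[of "e 3" "e 1"] alt[of "e 3" "e 2"] algebra_simps)
    have "B c p u v = B c' p (e 1) (e 2) * wedge11 (\<omega> 1) (\<omega> 2) c p u v
        + B c' p (e 1) (e 3) * wedge11 (\<omega> 1) (\<omega> 3) c p u v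
        + B c' p (e 2) (e 3) * wedge11 (\<omega> 2) (\<omega> 3) c p u v" if c: "c \<in> A" "p \<in> fst c" for c u v
    proof -
      have "B c p u v = B c' p (transition c c' p u) (transition c c' p v)"
        using B c c' p unfolding two_form_on_def by blast
      moreover have "\<omega> i c p w = \<omega> i c' p (transition c c' p w)" for i w
        using one_form_transition[OF coframing_one_form[OF \<omega>] c(1) c'(1)] c c' p by blast
      ultimately show ?thesis
        using eq[of "transition c c' p u" "transition c c' p v"] by (simp add: wedge11_def)
    qed
    then show ?thesis by blast
  qed
  then obtain f12 f13 f23 where f: "\<And>p c u v. \<lbrakk>p \<in> U; c \<in> A; p \<in> fst c\<rbrakk> \<Longrightarrow>
      B c p u v = f12 p * wedge11 (\<omega> 1) (\<omega> 2) c p u v + f13 p * wedge11 (\<omega> 1) (\<omega> 3) c p u v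
        + f23 p * wedge11 (\<omega> 2) (\<omega> 3) c p u v"
    by metis
  then have "forms_eq A U B (comb2 \<omega> f12 f13 f23)"
    by (simp add: forms_eq_def comb2_def fun_eq_iff)
  with coefficients2_smooth[OF \<omega> B this] that show thesis by blast
qed

end

section \<open>Structure equations and rescaling\<close>

text \<open>The action of \<open>g^-1\<close> for the structure group of 1-adapted coframes with
  sign +1, where r = 1/a. The functions \<open>b1\<close> and \<open>b2\<close> are entries of the
  inverse matrix, not of \<open>g\<close>.\<close>

definition rescaled_coframe ::
  "(3 \<Rightarrow> 'm form1) \<Rightarrow> ('m \<Rightarrow> real) \<Rightarrow> ('m \<Rightarrow> real) \<Rightarrow> ('m \<Rightarrow> real) \<Rightarrow> 3 \<Rightarrow> 'm form1" where
  "rescaled_coframe \<theta> r b1 b2 i = (\<lambda>c p v.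
     if i = 1 then r p * \<theta> 1 c p v
     else if i = 2 then r p * \<theta> 2 c p v
     else b1 p * \<theta> 1 c p v + b2 p * \<theta> 2 c p v + \<theta> 3 c p v)"

lemma rescaled_coframe_simps:
  "rescaled_coframe \<theta> r b1 b2 1 = (\<lambda>c p v. r p * \<theta> 1 c p v)"
  "rescaled_coframe \<theta> r b1 b2 2 = (\<lambda>c p v. r p * \<theta> 2 c p v)"
  "rescaled_coframe \<theta> r b1 b2 3 = (\<lambda>c p v. b1 p * \<theta> 1 c p v + b2 p * \<theta> 2 c p v + \<theta> 3 c p v)"
  by (simp_all add: rescaled_coframe_def)

lemma invariant_C_smooth: "invariant_C A U \<theta> C \<Longrightarrow> smooth_fun A U C"
  by (simp add: invariant_C_def)

lemma wedge12_comb2: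
  "wedge12 (\<omega> 1) (comb2 \<omega> f12 f13 f23) c p u v w = f23 p * vol \<omega> c p u v w"
  "wedge12 (\<omega> 2) (comb2 \<omega> f12 f13 f23) c p u v w = - f13 p * vol \<omega> c p u v w"
  by (simp_all add: wedge12_def comb2_def vol_def wedge11_def algebra_simps)

lemma wedge12_cong: "B c p = B' c p \<Longrightarrow> wedge12 \<alpha> B c p u v w = wedge12 \<alpha> B' c p u v w"
  by (simp add: wedge12_def)

lemma forms_eqD: "forms_eq A U \<alpha> \<beta> \<Longrightarrow> c \<in> A \<Longrightarrow> p \<in> fst c \<inter> U \<Longrightarrow> \<alpha> c p = \<beta> c p"
  by (simp add: forms_eq_def)

section \<open>Restriction to subsets\<close>

lemma forms_eq_subset: "forms_eq A V \<alpha> \<beta> \<Longrightarrow> U \<subseteq> V \<Longrightarrow> forms_eq A U \<alpha> \<beta>"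
  by (auto simp: forms_eq_def)

lemma one_form_on_subset:
  assumes \<alpha>: "one_form_on A V \<alpha>" and UV: "U \<subseteq> V"
  shows "one_form_on A U \<alpha>"
  unfolding one_form_on_def
proof (intro conjI ballI allI)
  fix c p assume "c \<in> A" "p \<in> fst c \<inter> U"
  then show "linear (\<alpha> c p)" using \<alpha> UV unfolding one_form_on_def by blast
next
  fix c c' p v assume "c \<in> A" "c' \<in> A" "p \<in> fst c \<inter> fst c' \<inter> U"
  then show "\<alpha> c p v = \<alpha> c' p (frechet_derivative (snd c' \<circ> chart_inv c) (at (snd c p)) v)"
    using \<alpha> UV unfolding one_form_on_def by blast
next
  fix c v assume "c \<in> A"
  then have "smooth_on (snd c ` (fst c \<inter> V)) (\<lambda>x. \<alpha> c (chart_inv c x) v)"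
    using \<alpha> unfolding one_form_on_def by blast
  then show "smooth_on (snd c ` (fst c \<inter> U)) (\<lambda>x. \<alpha> c (chart_inv c x) v)"
    by (rule smooth_on_subset) (use UV in blast)
qed

lemma coframing_on_subset: "coframing_on A V \<omega> \<Longrightarrow> U \<subseteq> V \<Longrightarrow> coframing_on A U \<omega>"
  unfolding coframing_on_def using one_form_on_subset by blast

lemma smooth_fun_mono: "smooth_fun A V f \<Longrightarrow> U \<subseteq> V \<Longrightarrow> smooth_fun A U f"
  unfolding smooth_fun_def by (meson image_mono inf_mono order_refl smooth_on_subset)

lemma adaptation_subset:
  assumes "adaptation A V \<omega> \<theta>" "U \<subseteq> V"
  shows "adaptation A U \<omega> \<theta>"
proof -
  obtain g :: "_ \<Rightarrow> real^3^3" where g: "coframing_on A V \<theta>"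
    "\<forall>i j. smooth_fun A V (\<lambda>p. g p $ i $ j)"
    "\<forall>p\<in>V. invertible (g p) \<and>
      g p $ 1 $ 2 = 0 \<and> g p $ 1 $ 3 = 0 \<and> g p $ 2 $ 1 = 0 \<and> g p $ 2 $ 3 = 0"
    "\<forall>i. forms_eq A V (\<theta> i) (\<lambda>c p v. \<Sum>j\<in>UNIV. matrix_inv (g p) $ i $ j * \<omega> j c p v)"
    using assms(1) unfolding adaptation_def by blast
  show ?thesis
    unfolding adaptation_def
    using g assms(2) coframing_on_subset[OF g(1) assms(2)] smooth_fun_mono[OF _ assms(2)]
      forms_eq_subset[OF _ assms(2)] by blast
qed

lemma one_adapted_subset: "one_adapted A V \<epsilon> \<theta> \<Longrightarrow> U \<subseteq> V \<Longrightarrow> one_adapted A U \<epsilon> \<theta>"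
  unfolding one_adapted_def using forms_eq_subset coframing_on_subset by blast

lemma invariant_C_subset: "invariant_C A V \<theta> C \<Longrightarrow> U \<subseteq> V \<Longrightarrow> invariant_C A U \<theta> C"
  unfolding invariant_C_def using forms_eq_subset smooth_fun_mono by blast

context open_in_manifold3
begin

lemma structure_equations:
  assumes \<theta>: "one_adapted A U \<epsilon> \<theta>" and C: "invariant_C A U \<theta> C" and \<epsilon>: "\<epsilon> \<in> {1, -1}"
  shows "\<exists>A1 A2 A3. smooth_fun A U A1 \<and> smooth_fun A U A2 \<and> smooth_fun A U A3 \<and>
    forms_eq A U (d1 (\<theta> 1)) (comb2 \<theta> A2 (\<lambda>p. A3 p - C p) (\<lambda>p. 1)) \<and>
    forms_eq A U (d1 (\<theta> 2)) (comb2 \<theta> (\<lambda>p. - A1 p) (\<lambda>p. \<epsilon>) (\<lambda>p. A3 p + C p))"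
proof -
  have cof: "coframing_on A U \<theta>" using \<theta> by (simp add: one_adapted_def)
  note d = two_form_on_d1[OF coframing_one_form[OF cof]]
  obtain a12 a13 a23 where a: "smooth_fun A U a12" "smooth_fun A U a13" "smooth_fun A U a23"
    "forms_eq A U (d1 (\<theta> 1)) (comb2 \<theta> a12 a13 a23)"
    by (rule coefficients2[OF cof d])
  obtain b12 b13 b23 where b: "smooth_fun A U b12" "smooth_fun A U b13" "smooth_fun A U b23"
    "forms_eq A U (d1 (\<theta> 2)) (comb2 \<theta> b12 b13 b23)"
    by (rule coefficients2[OF cof d])
  \<comment> \<open>Three wedge identities constrain the six coefficients; each is divided by the
    nonzero volume, and \<open>b13\<close> also uses that the square of \<epsilon> is 1.\<close>
  have vals: "a23 p = 1 \<and> b13 p = \<epsilon> \<and> b23 p - a13 p = 2 * C p" if "c \<in> A" "p \<in> fst c \<inter> U" for c p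
  proof -
    let ?v = "vol \<theta> c p (axis 1 1) (axis 2 1) (axis 3 1)"
    let ?W = "\<lambda>i j. wedge12 (\<theta> i) (d1 (\<theta> j)) c p (axis 1 1) (axis 2 1) (axis 3 1)"
    have v: "?v \<noteq> 0" by (rule vol_nonzero[OF cof that])
    have "wedge12 (\<theta> i) (d1 (\<theta> 1)) c p u v w = wedge12 (\<theta> i) (comb2 \<theta> a12 a13 a23) c p u v w"
      "wedge12 (\<theta> i) (d1 (\<theta> 2)) c p u v w = wedge12 (\<theta> i) (comb2 \<theta> b12 b13 b23) c p u v w"
      for i u v w
      by (rule wedge12_cong, rule forms_eqD[OF a(4) that], rule wedge12_cong, rule forms_eqD[OF b(4) that])
    then have W: "?W 1 1 = a23 p * ?v" "?W 2 2 = - b13 p * ?v" "?W 1 2 = b23 p * ?v" "?W 2 1 = - a13 p * ?v"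
      by (simp_all only: wedge12_comb2)
    have "?W 1 1 = ?v" "- \<epsilon> * ?W 2 2 = ?v"
      using \<theta> that by (simp_all add: one_adapted_def forms_eq_def fun_eq_iff)
    moreover have "?W 1 2 + ?W 2 1 = 2 * C p * ?v"
      using C that by (simp add: invariant_C_def forms_eq_def fun_eq_iff)
    ultimately have "a23 p * ?v = ?v" "(\<epsilon> * b13 p) * ?v = ?v" "(b23 p - a13 p) * ?v = (2 * C p) * ?v"
      unfolding W by (simp_all add: algebra_simps)
    then show ?thesis using v \<epsilon> by auto
  qed
  \<comment> \<open>Only the difference \<open>b23 - a13 = 2 C\<close> is prescribed. With
    \<open>A3\<close> as the mean, the two coefficients become \<open>A3 + C\<close> and
    \<open>A3 - C\<close>.\<close>
  define A3 where "A3 p = (a13 p + b23 p) / 2" for p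
  have "smooth_fun A U A3" unfolding A3_def using a b by (intro smooth_fun_intros) auto
  moreover have "forms_eq A U (d1 (\<theta> 1)) (comb2 \<theta> a12 (\<lambda>p. A3 p - C p) (\<lambda>p. 1))"
    using a(4) vals by (auto simp: forms_eq_def comb2_def fun_eq_iff A3_def field_simps)
  moreover have "forms_eq A U (d1 (\<theta> 2)) (comb2 \<theta> (\<lambda>p. - (- b12 p)) (\<lambda>p. \<epsilon>) (\<lambda>p. A3 p + C p))"
    using b(4) vals by (auto simp: forms_eq_def comb2_def fun_eq_iff A3_def field_simps)
  ultimately show ?thesis using a(1) smooth_fun_minus[OF b(1)] by blast
qed

lemma d1_comb1:
  assumes "coframing_on A U \<eta>" "smooth_fun A U f1" "smooth_fun A U f2" "smooth_fun A U f3"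
    and cp: "c \<in> A" "p \<in> fst c \<inter> U"
  shows "d1 (comb1 \<eta> f1 f2 f3) c p u v =
    (d0 f1 c p u * \<eta> 1 c p v - d0 f1 c p v * \<eta> 1 c p u + f1 p * d1 (\<eta> 1) c p u v) +
    (d0 f2 c p u * \<eta> 2 c p v - d0 f2 c p v * \<eta> 2 c p u + f2 p * d1 (\<eta> 2) c p u v) +
    (d0 f3 c p u * \<eta> 3 c p v - d0 f3 c p v * \<eta> 3 c p u + f3 p * d1 (\<eta> 3) c p u v)"
proof -
  note one = coframing_one_form[OF assms(1)]
  note s1 = one_form_scale[OF assms(2) one[of 1]] and s2 = one_form_scale[OF assms(3) one[of 2]]
    and s3 = one_form_scale[OF assms(4) one[of 3]]
  show ?thesis
    unfolding comb1_def d1_add[OF one_form_add[OF s1 s2] s3 cp] d1_add[OF s1 s2 cp]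
    by (simp only: d1_scale[OF assms(2) one cp] d1_scale[OF assms(3) one cp] d1_scale[OF assms(4) one cp])
qed

text \<open>The identity d(dC) = 0 written out in a coframing, from which both cases extract their
  information.\<close>

lemma closed_d0_comb1:
  assumes "coframing_on A U \<eta>" "smooth_fun A U f1" "smooth_fun A U f2" "smooth_fun A U f3"
    and C: "smooth_fun A U C" "forms_eq A U (d0 C) (comb1 \<eta> f1 f2 f3)"
    and cp: "c \<in> A" "p \<in> fst c \<inter> U"
  shows "(d0 f1 c p u * \<eta> 1 c p v - d0 f1 c p v * \<eta> 1 c p u + f1 p * d1 (\<eta> 1) c p u v) +
    (d0 f2 c p u * \<eta> 2 c p v - d0 f2 c p v * \<eta> 2 c p u + f2 p * d1 (\<eta> 2) c p u v) +
    (d0 f3 c p u * \<eta> 3 c p v - d0 f3 c p v * \<eta> 3 c p u + f3 p * d1 (\<eta> 3) c p u v) = 0"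
  using d1_comb1[OF assms(1-4) cp, of u v] d1_cong[OF one_form_on_d0[OF C(1)] C(2) cp, of u v]
    d1_d0[OF C(1) cp, of u v] by simp

section \<open>Effect of rescaling and translating the coframing\<close>

lemma coframing_rescaled:
  assumes "coframing_on A U \<theta>" "smooth_fun A U r" "smooth_fun A U b1" "smooth_fun A U b2"
    and r: "\<And>p. p \<in> U \<Longrightarrow> r p \<noteq> 0"
  shows "coframing_on A U (rescaled_coframe \<theta> r b1 b2)"
  unfolding coframing_on_def
proof (intro conjI ballI allI impI)
  fix i :: 3
  note one = coframing_one_form[OF assms(1)]
  consider "i = 1" | "i = 2" | "i = 3" using exhaust_3 by blast
  then show "one_form_on A U (rescaled_coframe \<theta> r b1 b2 i)"
    by cases (auto simp only: rescaled_coframe_simps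
        intro!: one_form_add one_form_scale one assms(2-4))
next
  fix c p i and a :: "3 \<Rightarrow> real"
  assume cp: "c \<in> A" "p \<in> fst c \<inter> U"
    and "\<forall>v. (\<Sum>i\<in>UNIV. a i * rescaled_coframe \<theta> r b1 b2 i c p v) = 0"
  then have "(a 1 * r p + a 3 * b1 p) * \<theta> 1 c p v + (a 2 * r p + a 3 * b2 p) * \<theta> 2 c p v
      + a 3 * \<theta> 3 c p v = 0" for v
    by (simp add: sum_3 rescaled_coframe_simps algebra_simps)
  from coframe_independent[OF assms(1) cp this]
  have "a 1 = 0 \<and> a 2 = 0 \<and> a 3 = 0" using r cp by auto
  then show "a i = 0" using exhaust_3[of i] by auto
qed

text \<open>If \<theta> is \<open>g^-1\<close> applied to \<omega> and the new coframing is
  \<open>h\<close> applied to \<theta>, then the new group element is \<open>g k\<close> with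
  \<open>k\<close> the inverse of \<open>h\<close>. The required zero pattern survives this
  product.\<close>

lemma adaptation_rescaled:
  assumes ad: "adaptation A U \<omega> \<theta>" and sm: "smooth_fun A U r" "smooth_fun A U b1" "smooth_fun A U b2"
    and r: "\<And>p. p \<in> U \<Longrightarrow> r p \<noteq> 0"
  shows "adaptation A U \<omega> (rescaled_coframe \<theta> r b1 b2)"
proof -
  let ?\<eta> = "rescaled_coframe \<theta> r b1 b2"
  obtain g :: "_ \<Rightarrow> real^3^3" where cof: "coframing_on A U \<theta>"
    and g: "\<And>i j. smooth_fun A U (\<lambda>p. g p $ i $ j)"
    and gU: "\<forall>p\<in>U. invertible (g p) \<and>
      g p $ 1 $ 2 = 0 \<and> g p $ 1 $ 3 = 0 \<and> g p $ 2 $ 1 = 0 \<and> g p $ 2 $ 3 = 0"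
    and \<theta>: "\<forall>i. forms_eq A U (\<theta> i) (\<lambda>c p v. \<Sum>j\<in>UNIV. matrix_inv (g p) $ i $ j * \<omega> j c p v)"
    using ad unfolding adaptation_def by blast
  define h :: "_ \<Rightarrow> real^3^3" where
    "h p = vector [vector [r p, 0, 0], vector [0, r p, 0], vector [b1 p, b2 p, 1]]" for p
  define k :: "_ \<Rightarrow> real^3^3" where
    "k p = vector [vector [1 / r p, 0, 0], vector [0, 1 / r p, 0], vector [- b1 p / r p, - b2 p / r p, 1]]" for p
  have kh: "k p ** h p = mat 1" if "p \<in> U" for p
    using r[OF that] by (simp add: matrix_matrix_mult_def vec_eq_iff forall_3 sum_3 mat_def h_def k_def)
  have inv_g: "g p ** matrix_inv (g p) = mat 1" if "p \<in> U" for p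
    using gU that by (metis invertible_def matrix_inv_eqI)
  have inv: "matrix_inv (g p ** k p) = h p ** matrix_inv (g p)" if "p \<in> U" for p
  proof (rule matrix_inv_eqI)
    have "(g p ** k p) ** (h p ** matrix_inv (g p)) = g p ** (k p ** h p) ** matrix_inv (g p)"
      by (simp add: matrix_mul_assoc)
    then show "(g p ** k p) ** (h p ** matrix_inv (g p)) = mat 1"
      by (simp add: kh inv_g that)
  qed
  show ?thesis unfolding adaptation_def
  proof (intro conjI exI[of _ "\<lambda>p. g p ** k p"])
    show "coframing_on A U ?\<eta>" by (rule coframing_rescaled[OF cof sm r])
    have k: "smooth_fun A U (\<lambda>p. k p $ i $ j)" for i j
      using exhaust_3[of i] exhaust_3[of j]
      by (auto simp: k_def intro!: smooth_fun_intros sm r)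
    show "\<forall>i j. smooth_fun A U (\<lambda>p. (g p ** k p) $ i $ j)"
      by (simp add: matrix_matrix_mult_def sum_3) (auto intro!: smooth_fun_intros g k)
    show "\<forall>p\<in>U. invertible (g p ** k p) \<and> (g p ** k p) $ 1 $ 2 = 0 \<and> (g p ** k p) $ 1 $ 3 = 0
        \<and> (g p ** k p) $ 2 $ 1 = 0 \<and> (g p ** k p) $ 2 $ 3 = 0"
    proof
      fix p assume p: "p \<in> U"
      have "invertible (k p)" using kh[OF p] invertible_right_inverse by blast
      then show "invertible (g p ** k p) \<and> (g p ** k p) $ 1 $ 2 = 0 \<and> (g p ** k p) $ 1 $ 3 = 0
          \<and> (g p ** k p) $ 2 $ 1 = 0 \<and> (g p ** k p) $ 2 $ 3 = 0"
        using gU p by (simp add: invertible_mult) (simp add: matrix_matrix_mult_def sum_3 k_def)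
    qed
    show "\<forall>i. forms_eq A U (?\<eta> i)
        (\<lambda>c p v. \<Sum>j\<in>UNIV. matrix_inv (g p ** k p) $ i $ j * \<omega> j c p v)"
      unfolding forms_eq_def
    proof (intro allI ballI ext)
      fix i c p v assume c: "c \<in> A" and p: "p \<in> fst c \<inter> U"
      let ?gi = "matrix_inv (g p)"
      have "\<theta> l c p v = (\<Sum>j\<in>UNIV. ?gi $ l $ j * \<omega> j c p v)" for l
        using \<theta> c p by (simp add: forms_eq_def)
      moreover have "matrix_inv (g p ** k p) = h p ** ?gi" using inv p by blast
      ultimately show "?\<eta> i c p v = (\<Sum>j\<in>UNIV. matrix_inv (g p ** k p) $ i $ j * \<omega> j c p v)"
        using exhaust_3[of i]
        by (auto simp: rescaled_coframe_simps matrix_matrix_mult_def sum_3 h_def algebra_simps)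
    qed
  qed
qed

text \<open>All terms with dr cancel: in the pure products because \<open>\<theta> i\<close> is
  wedged with itself, and in the mixed sum because
  \<open>\<theta> 1 \<and> dr \<and> \<theta> 2\<close> and
  \<open>\<theta> 2 \<and> dr \<and> \<theta> 1\<close> are opposite. The translation drops out of
  the volume form. Since only a common factor remains, the 1-adapted normalization and
  \<open>C\<close> persist.\<close>

lemma wedge_rescaled:
  assumes "coframing_on A U \<theta>" "smooth_fun A U r" "c \<in> A" "p \<in> fst c \<inter> U"
    and \<eta>: "\<eta> = rescaled_coframe \<theta> r b1 b2"
  shows "wedge12 (\<eta> 1) (d1 (\<eta> 1)) c p u v w = (r p)\<^sup>2 * wedge12 (\<theta> 1) (d1 (\<theta> 1)) c p u v w"
    and "wedge12 (\<eta> 2) (d1 (\<eta> 2)) c p u v w = (r p)\<^sup>2 * wedge12 (\<theta> 2) (d1 (\<theta> 2)) c p u v w"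
    and "wedge12 (\<eta> 1) (d1 (\<eta> 2)) c p u v w + wedge12 (\<eta> 2) (d1 (\<eta> 1)) c p u v w =
      (r p)\<^sup>2 * (wedge12 (\<theta> 1) (d1 (\<theta> 2)) c p u v w + wedge12 (\<theta> 2) (d1 (\<theta> 1)) c p u v w)"
    and "vol \<eta> c p u v w = (r p)\<^sup>2 * vol \<theta> c p u v w"
proof -
  note d = d1_scale[OF assms(2) coframing_one_form[OF assms(1)] assms(3,4)]
  show "wedge12 (\<eta> 1) (d1 (\<eta> 1)) c p u v w = (r p)\<^sup>2 * wedge12 (\<theta> 1) (d1 (\<theta> 1)) c p u v w"
    "wedge12 (\<eta> 2) (d1 (\<eta> 2)) c p u v w = (r p)\<^sup>2 * wedge12 (\<theta> 2) (d1 (\<theta> 2)) c p u v w"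
    "wedge12 (\<eta> 1) (d1 (\<eta> 2)) c p u v w + wedge12 (\<eta> 2) (d1 (\<eta> 1)) c p u v w =
      (r p)\<^sup>2 * (wedge12 (\<theta> 1) (d1 (\<theta> 2)) c p u v w + wedge12 (\<theta> 2) (d1 (\<theta> 1)) c p u v w)"
    "vol \<eta> c p u v w = (r p)\<^sup>2 * vol \<theta> c p u v w"
    unfolding \<eta> vol_def wedge12_def wedge11_def rescaled_coframe_simps d
    by (simp_all add: algebra_simps power2_eq_square)
qed

lemma one_adapted_rescaled:
  assumes "one_adapted A U \<epsilon> \<theta>" "smooth_fun A U r" "smooth_fun A U b1" "smooth_fun A U b2"
    and "\<And>p. p \<in> U \<Longrightarrow> r p \<noteq> 0"
  shows "one_adapted A U \<epsilon> (rescaled_coframe \<theta> r b1 b2)"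
proof -
  have cof: "coframing_on A U \<theta>" using assms(1) by (simp add: one_adapted_def)
  let ?\<eta> = "rescaled_coframe \<theta> r b1 b2"
  have \<theta>: "wedge12 (\<theta> 1) (d1 (\<theta> 1)) c p u v w = vol \<theta> c p u v w"
    "- \<epsilon> * wedge12 (\<theta> 2) (d1 (\<theta> 2)) c p u v w = vol \<theta> c p u v w"
    if "c \<in> A" "p \<in> fst c \<inter> U" for c p u v w
    using assms(1) that by (simp_all add: one_adapted_def forms_eq_def fun_eq_iff)
  note W = wedge_rescaled[OF cof assms(2) _ _ refl]
  show ?thesis
    unfolding one_adapted_def forms_eq_def
  proof (intro conjI ballI ext)
    show "coframing_on A U ?\<eta>" by (rule coframing_rescaled[OF cof assms(2-5)])
    fix c p u v w assume cp: "c \<in> A" "p \<in> fst c \<inter> U"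
    show "wedge12 (?\<eta> 1) (d1 (?\<eta> 1)) c p u v w = vol ?\<eta> c p u v w"
      unfolding W(1,4)[OF cp] \<theta>(1)[OF cp] ..
    have "- \<epsilon> * ((r p)\<^sup>2 * wedge12 (\<theta> 2) (d1 (\<theta> 2)) c p u v w) =
        (r p)\<^sup>2 * (- \<epsilon> * wedge12 (\<theta> 2) (d1 (\<theta> 2)) c p u v w)"
      by simp
    then show "- \<epsilon> * wedge12 (?\<eta> 2) (d1 (?\<eta> 2)) c p u v w = vol ?\<eta> c p u v w"
      unfolding W(2,4)[OF cp] \<theta>(2)[OF cp] .
  qed
qed

lemma invariant_C_rescaled:
  assumes "coframing_on A U \<theta>" "invariant_C A U \<theta> C" "smooth_fun A U r"
  shows "invariant_C A U (rescaled_coframe \<theta> r b1 b2) C"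
  using assms(2) unfolding invariant_C_def forms_eq_def fun_eq_iff
  by (simp add: wedge_rescaled[OF assms(1,3) _ _ refl])

section \<open>Smooth angles\<close>

lemma smooth_angle_exists:
  assumes x: "smooth_fun A U x" and y: "smooth_fun A U y"
    and xy: "\<And>p. p \<in> U \<Longrightarrow> (x p)\<^sup>2 + (y p)\<^sup>2 = 1"
  shows "\<exists>\<xi>. smooth_angle A U \<xi> \<and> (\<forall>p\<in>U. cos (\<xi> p) = x p \<and> sin (\<xi> p) = y p)"
proof -
  have "\<exists>t. cos t = x p \<and> sin t = y p" if "p \<in> U" for p
    using sincos_total_2pi_le[OF xy[OF that]] by metis
  \<comment> \<open>The representatives are chosen pointwise and may jump by multiples of
    \<open>2 * pi\<close>; only local lifts have to be smooth.\<close>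
  then obtain \<xi> where \<xi>: "\<And>p. p \<in> U \<Longrightarrow> cos (\<xi> p) = x p \<and> sin (\<xi> p) = y p"
    by metis
  have "smooth_angle A U \<xi>" unfolding smooth_angle_def
  proof
    fix p assume p: "p \<in> U"
    \<comment> \<open>\<open>z q\<close> and \<open>w q\<close> are the cosine and sine of the angle
      from the direction at p to the direction at q. On \<open>V\<close> this angle is less than a
      right angle in absolute value, so \<open>arctan (w q / z q)\<close> recovers it
      smoothly.\<close>
    define z where "z q = x q * x p + y q * y p" for q
    define w where "w q = y q * x p - x q * y p" for q
    define V where "V = {q \<in> U. z q > 0}"
    define f where "f q = \<xi> p + arctan (w q / z q)" for q
    have z: "smooth_fun A U z" and w: "smooth_fun A U w"
      unfolding z_def w_def by (intro smooth_fun_intros x y)+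
    have "open (z -` {0<..} \<inter> U)"
      using smooth_fun_imp_continuous_on[OF z] continuous_on_open_vimage[OF open_U] open_greaterThan
      by blast
    moreover have "V = z -` {0<..} \<inter> U" by (auto simp: V_def)
    ultimately have "open V" by simp
    have "V \<subseteq> U" by (auto simp: V_def)
    have "p \<in> V" using p xy[OF p] by (simp add: V_def z_def power2_eq_square)
    interpret V: open_in_manifold3 A V
      by unfold_locales (rule manifold, rule \<open>open V\<close>)
    have "smooth_fun A V f"
      unfolding f_def
      by (intro V.smooth_fun_intros smooth_fun_mono[OF _ \<open>V \<subseteq> U\<close>] z w) (simp add: V_def)
    moreover have "\<exists>k::int. \<xi> q = f q + 2 * pi * of_int k" if q: "q \<in> V" for q
    proof -
      have zq: "z q > 0" and qU: "q \<in> U" using q by (auto simp: V_def)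
      have "(z q)\<^sup>2 + (w q)\<^sup>2 = ((x q)\<^sup>2 + (y q)\<^sup>2) * ((x p)\<^sup>2 + (y p)\<^sup>2)"
        by (simp add: z_def w_def power2_eq_square algebra_simps)
      then have zw: "(z q)\<^sup>2 + (w q)\<^sup>2 = 1" using xy p qU by simp
      have "1 + (w q / z q)\<^sup>2 = (1 / z q)\<^sup>2"
        using zw zq by (simp add: field_simps power2_eq_square)
      then have sq: "sqrt (1 + (w q / z q)\<^sup>2) = 1 / z q" using zq by simp
      have ca: "cos (arctan (w q / z q)) = z q" and sa: "sin (arctan (w q / z q)) = w q"
        using zq by (simp_all add: cos_arctan sin_arctan sq)
      have "cos (f q) = x p * z q - y p * w q" "sin (f q) = y p * z q + x p * w q"
        by (simp_all add: f_def cos_add sin_add ca sa \<xi>[OF p])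
      \<comment> \<open>Rotating back by the angle at p returns the original pair at q.\<close>
      moreover have "x p * z q - y p * w q = x q * ((x p)\<^sup>2 + (y p)\<^sup>2)"
        "y p * z q + x p * w q = y q * ((x p)\<^sup>2 + (y p)\<^sup>2)"
        by (simp_all add: z_def w_def power2_eq_square algebra_simps)
      ultimately have "cos (\<xi> q) = cos (f q)" "sin (\<xi> q) = sin (f q)"
        using \<xi>[OF qU] xy[OF p] by simp_all
      then show ?thesis using sin_cos_eq_iff[of "\<xi> q" "f q"] by auto
    qed
    ultimately show "\<exists>V f. open V \<and> p \<in> V \<and> V \<subseteq> U \<and> smooth_fun A V f \<and>
        (\<forall>q\<in>V. \<exists>k::int. \<xi> q = f q + 2 * pi * of_int k)"
      using \<open>open V\<close> \<open>p \<in> V\<close> \<open>V \<subseteq> U\<close> by blast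
  qed
  with \<xi> show ?thesis by blast
qed

text \<open>\<open>d(dC) = 0\<close> together with \<open>c1\<^sup>2 + c2\<^sup>2 = 1\<close> determines \<open>A3\<close>.\<close>

lemma A3_forced:
  assumes cof: "coframing_on A U \<eta>"
    and sm: "smooth_fun A U c1" "smooth_fun A U c2" "smooth_fun A U C"
    and dC: "forms_eq A U (d0 C) (comb1 \<eta> c1 c2 (\<lambda>p. 0))"
    and unit: "\<And>p. p \<in> U \<Longrightarrow> c1 p * c1 p + c2 p * c2 p = 1"
    and d: "forms_eq A U (d1 (\<eta> 1)) (comb2 \<eta> A2 (\<lambda>p. A3 p - C p) (\<lambda>p. 1))"
      "forms_eq A U (d1 (\<eta> 2)) (comb2 \<eta> A1' (\<lambda>p. \<epsilon>) (\<lambda>p. A3 p + C p))"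
    and p: "p \<in> U"
  shows "A3 p = C p * ((c1 p)\<^sup>2 - (c2 p)\<^sup>2) - (1 + \<epsilon>) * c1 p * c2 p"
proof -
  obtain c where c: "c \<in> A" "p \<in> fst c" by (rule in_some_chart)
  then have cp: "c \<in> A" "p \<in> fst c \<inter> U" using p by auto
  obtain x1 x2 x3 where x: "forms_eq A U (d0 c1) (comb1 \<eta> x1 x2 x3)"
    using coefficients1[OF cof one_form_on_d0[OF sm(1)]] by blast
  obtain y1 y2 y3 where y: "forms_eq A U (d0 c2) (comb1 \<eta> y1 y2 y3)"
    using coefficients1[OF cof one_form_on_d0[OF sm(2)]] by blast
  have x': "d0 c1 c p u = x1 p * \<eta> 1 c p u + x2 p * \<eta> 2 c p u + x3 p * \<eta> 3 c p u" for u
    using forms_eqD[OF x cp] by (simp add: comb1_def)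
  have y': "d0 c2 c p u = y1 p * \<eta> 1 c p u + y2 p * \<eta> 2 c p u + y3 p * \<eta> 3 c p u" for u
    using forms_eqD[OF y cp] by (simp add: comb1_def)
  have d1': "d1 (\<eta> 1) c p u v = A2 p * wedge11 (\<eta> 1) (\<eta> 2) c p u v
      + (A3 p - C p) * wedge11 (\<eta> 1) (\<eta> 3) c p u v + wedge11 (\<eta> 2) (\<eta> 3) c p u v" for u v
    using forms_eqD[OF d(1) cp] by (simp add: comb2_def)
  have d2': "d1 (\<eta> 2) c p u v = A1' p * wedge11 (\<eta> 1) (\<eta> 2) c p u v
      + \<epsilon> * wedge11 (\<eta> 1) (\<eta> 3) c p u v + (A3 p + C p) * wedge11 (\<eta> 2) (\<eta> 3) c p u v" for u v
    using forms_eqD[OF d(2) cp] by (simp add: comb2_def)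
  have d0z: "d0 (\<lambda>p. 0) c p u = 0" for u
    using d0_eqI[OF has_derivative_const] by metis
  \<comment> \<open>The three coefficients of d(dC) = 0. The last two give the derivatives
    \<open>x3\<close> and \<open>y3\<close> of \<open>c1\<close> and \<open>c2\<close> along the
    third frame direction.\<close>
  have "(y1 p - x2 p + c1 p * A2 p + c2 p * A1' p) * wedge11 (\<eta> 1) (\<eta> 2) c p u v
      + (- x3 p + c1 p * (A3 p - C p) + c2 p * \<epsilon>) * wedge11 (\<eta> 1) (\<eta> 3) c p u v
      + (- y3 p + c1 p + c2 p * (A3 p + C p)) * wedge11 (\<eta> 2) (\<eta> 3) c p u v = 0" for u v
    using closed_d0_comb1[OF cof sm(1,2) smooth_fun_const sm(3) dC cp, of u v]
    by (simp add: x' y' d1' d2' d0z wedge11_def algebra_simps)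
  from coframe2_independent[OF cof cp this]
  have 1: "x3 p = c1 p * (A3 p - C p) + c2 p * \<epsilon>" "y3 p = c1 p + c2 p * (A3 p + C p)"
    by auto
  \<comment> \<open>Differentiating the unit condition gives a second relation between
    \<open>x3\<close> and \<open>y3\<close>; eliminating them leaves a linear equation for
    \<open>A3\<close> with leading coefficient \<open>c1 * c1 + c2 * c2 = 1\<close>.\<close>
  have "d0 (\<lambda>p. c1 p * c1 p + c2 p * c2 p) c p u = 0" for u
    using d0_cong[OF smooth_fun_const[of 1] _ cp, of "\<lambda>p. c1 p * c1 p + c2 p * c2 p"] unit
      d0_eqI[OF has_derivative_const[of 1], of c p] by simp
  then have s: "c1 p * d0 c1 c p u + c2 p * d0 c2 c p u = 0" for u
    using d0_add[OF smooth_fun_mult[OF sm(1,1)] smooth_fun_mult[OF sm(2,2)] cp, of u]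
    by (simp add: d0_mult[OF sm(1,1) cp] d0_mult[OF sm(2,2) cp])
  have "(c1 p * x1 p + c2 p * y1 p) * \<eta> 1 c p u + (c1 p * x2 p + c2 p * y2 p) * \<eta> 2 c p u
      + (c1 p * x3 p + c2 p * y3 p) * \<eta> 3 c p u = 0" for u
    using s[of u] unfolding x' y' by (simp add: algebra_simps)
  from coframe_independent[OF cof cp this] have "c1 p * x3 p + c2 p * y3 p = 0" by blast
  then have "A3 p * (c1 p * c1 p + c2 p * c2 p) = C p * ((c1 p)\<^sup>2 - (c2 p)\<^sup>2) - (1 + \<epsilon>) * c1 p * c2 p"
    unfolding 1 by (simp add: algebra_simps power2_eq_square)
  then show ?thesis by (simp add: unit[OF p])
qed

section \<open>Normal form for vanishing \<open>C3\<close>\<close>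

lemma horizontal_case:
  assumes ad: "adaptation A U \<omega> \<theta>" and one: "one_adapted A U \<epsilon> \<theta>" and C: "invariant_C A U \<theta> C"
    and \<epsilon>: "\<epsilon> \<in> {1, -1}" and \<delta>: "\<delta> \<in> {1, -1}"
    and dC: "forms_eq A U (d0 C) (comb1 \<theta> C1 C2 C3)"
    and nc: "\<forall>c\<in>A. \<forall>p\<in>fst c \<inter> U. d0 C c p \<noteq> (\<lambda>v. 0)"
    and C3: "\<forall>p\<in>U. C3 p = 0"
  shows "\<exists>\<eta> A1 A2 A3 B1 B2 B3 \<xi>.
          adaptation A U \<omega> \<eta> \<and>
          smooth_fun A U A1 \<and> smooth_fun A U A2 \<and> smooth_fun A U A3 \<and>
          smooth_fun A U B1 \<and> smooth_fun A U B2 \<and> smooth_fun A U B3 \<and>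
          smooth_angle A U \<xi> \<and>
          forms_eq A U (d1 (\<eta> 1)) (comb2 \<eta> A2 (\<lambda>p. A3 p - C p) (\<lambda>p. 1)) \<and>
          forms_eq A U (d1 (\<eta> 2)) (comb2 \<eta> (\<lambda>p. - A1 p) (\<lambda>p. \<epsilon>) (\<lambda>p. A3 p + C p)) \<and>
          forms_eq A U (d1 (\<eta> 3)) (comb2 \<eta> B3 B2 B1) \<and>
          forms_eq A U (d0 C) (comb1 \<eta> (\<lambda>p. cos (\<xi> p)) (\<lambda>p. \<delta> * sin (\<xi> p)) (\<lambda>p. 0)) \<and>
          ((\<forall>p\<in>U. translation_regular \<epsilon> (C p) (C1 p) (C2 p)) \<longrightarrow>
             (\<forall>p\<in>U. A1 p = 0 \<and> A2 p = 0))"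
proof -
  have cof: "coframing_on A U \<theta>" using one by (simp add: one_adapted_def)
  have Cs: "smooth_fun A U C" by (rule invariant_C_smooth[OF C])
  note sm = coefficients1_smooth[OF cof one_form_on_d0[OF Cs] dC]
  have pos: "(C1 p)\<^sup>2 + (C2 p)\<^sup>2 > 0" if p: "p \<in> U" for p
  proof -
    obtain c where c: "c \<in> A" "p \<in> fst c" by (rule in_some_chart)
    have "d0 C c p = comb1 \<theta> C1 C2 C3 c p" using forms_eqD[OF dC c(1)] c p by blast
    then have "C1 p \<noteq> 0 \<or> C2 p \<noteq> 0" using nc C3 c p by (auto simp: comb1_def)
    then show ?thesis by (simp add: sum_power2_gt_zero_iff)
  qed
  \<comment> \<open>Multiplying the first two forms by r divides the coefficients of dC by r, so the
    new pair \<open>(c1, c2)\<close> is a unit vector.\<close>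
  define r where "r p = sqrt ((C1 p)\<^sup>2 + (C2 p)\<^sup>2)" for p
  have r: "smooth_fun A U r"
    unfolding r_def power2_eq_square
    by (intro smooth_fun_intros sm) (use pos in \<open>simp add: power2_eq_square\<close>)
  have r_pos: "r p > 0" and rr: "r p * r p = (C1 p)\<^sup>2 + (C2 p)\<^sup>2" if "p \<in> U" for p
    using pos[OF that] by (simp_all add: r_def)
  then have r0: "r p \<noteq> 0" if "p \<in> U" for p using that by fastforce
  define c1 where "c1 p = C1 p / r p" for p
  define c2 where "c2 p = C2 p / r p" for p
  have c12: "smooth_fun A U c1" "smooth_fun A U c2"
    unfolding c1_def c2_def by (intro smooth_fun_intros sm r r0; assumption)+
  have unit: "c1 p * c1 p + c2 p * c2 p = 1" if "p \<in> U" for p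
  proof -
    have "c1 p * c1 p + c2 p * c2 p = ((C1 p)\<^sup>2 + (C2 p)\<^sup>2) / (r p * r p)"
      by (simp add: c1_def c2_def power2_eq_square add_divide_distrib)
    then show ?thesis unfolding rr[OF that, symmetric] using r0[OF that] by simp
  qed
  define \<eta> where "\<eta> = rescaled_coframe \<theta> r (\<lambda>p. 0) (\<lambda>p. 0)"
  have ad0: "adaptation A U \<omega> \<eta>"
    unfolding \<eta>_def by (rule adaptation_rescaled[OF ad r smooth_fun_const smooth_fun_const r0])
  have one0: "one_adapted A U \<epsilon> \<eta>"
    unfolding \<eta>_def by (rule one_adapted_rescaled[OF one r smooth_fun_const smooth_fun_const r0])
  have cof0: "coframing_on A U \<eta>" using one0 by (simp add: one_adapted_def)
  have inv0: "invariant_C A U \<eta> C"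
    unfolding \<eta>_def by (rule invariant_C_rescaled[OF cof C r])
  have dC0: "forms_eq A U (d0 C) (comb1 \<eta> c1 c2 (\<lambda>p. 0))"
    using dC C3 r0 by (simp add: forms_eq_def comb1_def \<eta>_def rescaled_coframe_simps c1_def c2_def fun_eq_iff)
  obtain A1 A2 A3 where A: "smooth_fun A U A1" "smooth_fun A U A2" "smooth_fun A U A3"
    and d1: "forms_eq A U (d1 (\<eta> 1)) (comb2 \<eta> A2 (\<lambda>p. A3 p - C p) (\<lambda>p. 1))"
    and d2: "forms_eq A U (d1 (\<eta> 2)) (comb2 \<eta> (\<lambda>p. - A1 p) (\<lambda>p. \<epsilon>) (\<lambda>p. A3 p + C p))"
    using structure_equations[OF one0 inv0 \<epsilon>] by blast
  have \<delta>2: "\<delta> * \<delta> = 1" using \<delta> by auto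
  have "(c1 p)\<^sup>2 + (\<delta> * c2 p)\<^sup>2 = 1" if "p \<in> U" for p
  proof -
    \<comment> \<open>The angle is taken for \<open>(c1, \<delta> * c2)\<close> because the second
      coefficient of dC must read \<open>\<delta> * sin\<close>, and \<delta> is its own
      inverse.\<close>
    have "(c1 p)\<^sup>2 + (\<delta> * c2 p)\<^sup>2 = c1 p * c1 p + (\<delta> * \<delta>) * (c2 p * c2 p)"
      by (simp add: power2_eq_square algebra_simps)
    then show ?thesis using unit[OF that] \<delta>2 by simp
  qed
  then obtain \<xi> where \<xi>: "smooth_angle A U \<xi>" "\<forall>p\<in>U. cos (\<xi> p) = c1 p \<and> sin (\<xi> p) = \<delta> * c2 p"
    using smooth_angle_exists[OF c12(1) smooth_fun_mult[OF smooth_fun_const c12(2)]] by blast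
  have angle: "c1 p = cos (\<xi> p)" "c2 p = \<delta> * sin (\<xi> p)" if "p \<in> U" for p
    using \<xi>(2) that \<delta>2 by (simp_all flip: mult.assoc)
  show ?thesis
  \<comment> \<open>If regularity fails somewhere on \<open>U\<close>, the scaled coframing itself
    is the witness, with \<open>A1\<close> and \<open>A2\<close> kept. Otherwise the translation
    system is solvable smoothly on all of \<open>U\<close>.\<close>
  proof (cases "\<forall>p\<in>U. translation_regular \<epsilon> (C p) (C1 p) (C2 p)")
    case False
    obtain B3 B2 B1 where B: "smooth_fun A U B3" "smooth_fun A U B2" "smooth_fun A U B1"
      "forms_eq A U (d1 (\<eta> 3)) (comb2 \<eta> B3 B2 B1)"
      using coefficients2[OF cof0 two_form_on_d1[OF coframing_one_form[OF cof0]], of 3] by blast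
    have "forms_eq A U (d0 C) (comb1 \<eta> (\<lambda>p. cos (\<xi> p)) (\<lambda>p. \<delta> * sin (\<xi> p)) (\<lambda>p. 0))"
      using dC0 angle by (simp add: forms_eq_def comb1_def)
    with False ad0 A d1 d2 B \<xi>(1) show ?thesis by blast
  next
    case True
    \<comment> \<open>The determinant of the linear system for the translation, displayed in
      \<open>b_eq\<close>.\<close>
    define D where "D p = (A3 p)\<^sup>2 - (C p)\<^sup>2 - \<epsilon>" for p
    have D: "D p \<noteq> 0" if p: "p \<in> U" for p
    proof -
      have "A3 p = C p * ((c1 p)\<^sup>2 - (c2 p)\<^sup>2) - (1 + \<epsilon>) * c1 p * c2 p"
        by (rule A3_forced[OF cof0 c12 Cs dC0 unit d1 d2 p])
      \<comment> \<open>Homogeneity of degree 0 moves the formula from the unit coefficients back to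
        \<open>C1\<close> and \<open>C2\<close> of \<theta>, in which regularity is assumed.\<close>
      also have "\<dots> = (C p * ((C1 p)\<^sup>2 - (C2 p)\<^sup>2) - (1 + \<epsilon>) * C1 p * C2 p) / (r p * r p)"
        using r0[OF p] by (simp add: c1_def c2_def power2_eq_square field_simps)
      also have "\<dots> = A3_normalized \<epsilon> (C p) (C1 p) (C2 p)"
        by (simp only: A3_normalized_def rr[OF p])
      finally show ?thesis using True p by (simp add: translation_regular_def D_def)
    qed
    \<comment> \<open>Cramer's rule for the two equations in \<open>b_eq\<close>, which say that the
      coefficients of \<open>\<eta> 1 \<and> \<eta> 2\<close> vanish after the translation.\<close>
    define b1 where "b1 p = (\<epsilon> * A2 p + (A3 p - C p) * A1 p) / D p" for p
    define b2 where "b2 p = (A1 p + (A3 p + C p) * A2 p) / D p" for p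
    have b: "smooth_fun A U b1" "smooth_fun A U b2"
      unfolding b1_def b2_def D_def power2_eq_square
      by (intro smooth_fun_intros A Cs; use D in \<open>simp add: D_def power2_eq_square\<close>)+
    have b_eq: "A2 p + b1 p - (A3 p - C p) * b2 p = 0" "- A1 p + (A3 p + C p) * b1 p - \<epsilon> * b2 p = 0"
      if "p \<in> U" for p
    proof -
      have 1: "b1 p * D p = \<epsilon> * A2 p + (A3 p - C p) * A1 p" "b2 p * D p = A1 p + (A3 p + C p) * A2 p"
        using D[OF that] by (simp_all add: b1_def b2_def)
      have "(A2 p + b1 p - (A3 p - C p) * b2 p) * D p
          = A2 p * D p + b1 p * D p - (A3 p - C p) * (b2 p * D p)"
        "(- A1 p + (A3 p + C p) * b1 p - \<epsilon> * b2 p) * D p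
          = - A1 p * D p + (A3 p + C p) * (b1 p * D p) - \<epsilon> * (b2 p * D p)"
        by (simp_all add: algebra_simps)
      then have "(A2 p + b1 p - (A3 p - C p) * b2 p) * D p = 0"
        "(- A1 p + (A3 p + C p) * b1 p - \<epsilon> * b2 p) * D p = 0"
        unfolding 1 by (simp_all add: D_def power2_eq_square algebra_simps)
      then show "A2 p + b1 p - (A3 p - C p) * b2 p = 0" "- A1 p + (A3 p + C p) * b1 p - \<epsilon> * b2 p = 0"
        using D[OF that] by simp_all
    qed
    define \<sigma> where "\<sigma> = rescaled_coframe \<eta> (\<lambda>p. 1) b1 b2"
    have \<sigma>: "\<sigma> 1 = \<eta> 1" "\<sigma> 2 = \<eta> 2" "\<sigma> 3 = (\<lambda>c p v. b1 p * \<eta> 1 c p v + b2 p * \<eta> 2 c p v + \<eta> 3 c p v)"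
      by (simp_all add: \<sigma>_def rescaled_coframe_simps)
    have ad1: "adaptation A U \<omega> \<sigma>"
      unfolding \<sigma>_def by (rule adaptation_rescaled[OF ad0 smooth_fun_const b]) simp
    have cof1: "coframing_on A U \<sigma>" using ad1 by (simp add: adaptation_def)
    obtain B3 B2 B1 where B: "smooth_fun A U B3" "smooth_fun A U B2" "smooth_fun A U B1"
      "forms_eq A U (d1 (\<sigma> 3)) (comb2 \<sigma> B3 B2 B1)"
      using coefficients2[OF cof1 two_form_on_d1[OF coframing_one_form[OF cof1]], of 3] by blast
    have "forms_eq A U (d0 C) (comb1 \<sigma> (\<lambda>p. cos (\<xi> p)) (\<lambda>p. \<delta> * sin (\<xi> p)) (\<lambda>p. 0))"
      using dC0 angle by (simp add: forms_eq_def comb1_def \<sigma>)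
    moreover have "forms_eq A U (d1 (\<sigma> 1)) (comb2 \<sigma> (\<lambda>p. 0) (\<lambda>p. A3 p - C p) (\<lambda>p. 1))"
      unfolding forms_eq_def
    proof (intro ballI ext)
      fix c p u v assume cp: "c \<in> A" "p \<in> fst c \<inter> U"
      \<comment> \<open>The translation adds \<open>b2\<close> times
        \<open>\<eta> 1 \<and> \<eta> 2\<close> to \<open>\<eta> 1 \<and> \<eta> 3\<close> and
        subtracts \<open>b1\<close> times it from \<open>\<eta> 2 \<and> \<eta> 3\<close>; only that
        one coefficient changes.\<close>
      have "comb2 \<sigma> (\<lambda>p. 0) (\<lambda>p. A3 p - C p) (\<lambda>p. 1) c p u v =
          comb2 \<eta> A2 (\<lambda>p. A3 p - C p) (\<lambda>p. 1) c p u v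
          - (A2 p + b1 p - (A3 p - C p) * b2 p) * wedge11 (\<eta> 1) (\<eta> 2) c p u v"
        by (simp add: comb2_def wedge11_def \<sigma> algebra_simps)
      then show "d1 (\<sigma> 1) c p u v = comb2 \<sigma> (\<lambda>p. 0) (\<lambda>p. A3 p - C p) (\<lambda>p. 1) c p u v"
        using forms_eqD[OF d1 cp] b_eq(1)[of p] cp by (simp add: \<sigma>(1))
    qed
    moreover have "forms_eq A U (d1 (\<sigma> 2)) (comb2 \<sigma> (\<lambda>p. - 0) (\<lambda>p. \<epsilon>) (\<lambda>p. A3 p + C p))"
      unfolding forms_eq_def
    proof (intro ballI ext)
      fix c p u v assume cp: "c \<in> A" "p \<in> fst c \<inter> U"
      have "comb2 \<sigma> (\<lambda>p. - 0) (\<lambda>p. \<epsilon>) (\<lambda>p. A3 p + C p) c p u v =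
          comb2 \<eta> (\<lambda>p. - A1 p) (\<lambda>p. \<epsilon>) (\<lambda>p. A3 p + C p) c p u v
          - (- A1 p + (A3 p + C p) * b1 p - \<epsilon> * b2 p) * wedge11 (\<eta> 1) (\<eta> 2) c p u v"
        by (simp add: comb2_def wedge11_def \<sigma> algebra_simps)
      then show "d1 (\<sigma> 2) c p u v = comb2 \<sigma> (\<lambda>p. - 0) (\<lambda>p. \<epsilon>) (\<lambda>p. A3 p + C p) c p u v"
        using forms_eqD[OF d2 cp] b_eq(2)[of p] cp by (simp add: \<sigma>(2))
    qed
    moreover have "\<forall>p\<in>U. (0::real) = 0 \<and> (0::real) = 0" by simp
    ultimately show ?thesis
      using ad1 A(3) B \<xi>(1) smooth_fun_const[of 0]
      by (intro exI[of _ \<sigma>] exI[of _ "\<lambda>p. 0"] exI[of _ A3] exI[of _ B1] exI[of _ B2] exI[of _ B3]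
          exI[of _ \<xi>] conjI impI) assumption+
  qed
qed

section \<open>Normal form for nonvanishing \<open>C3\<close>\<close>

lemma transverse_coframe:
  assumes ad: "adaptation A U \<omega> \<theta>" and one: "one_adapted A U \<epsilon> \<theta>" and C: "invariant_C A U \<theta> C"
    and dC: "forms_eq A U (d0 C) (comb1 \<theta> C1 C2 C3)"
    and C3: "\<forall>p\<in>U. C3 p \<noteq> 0"
  shows "\<exists>\<eta>. adaptation A U \<omega> \<eta> \<and> one_adapted A U \<epsilon> \<eta> \<and> invariant_C A U \<eta> C \<and>
    forms_eq A U (d0 C) (comb1 \<eta> (\<lambda>p. 0) (\<lambda>p. 0) C3)"
proof -
  have cof: "coframing_on A U \<theta>" using one by (simp add: one_adapted_def)
  have Cs: "smooth_fun A U C" by (rule invariant_C_smooth[OF C])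
  note sm = coefficients1_smooth[OF cof one_form_on_d0[OF Cs] dC]
  \<comment> \<open>This makes \<open>\<eta> 3\<close> equal to dC / C3 while the third coefficient
    of dC stays the same function \<open>C3\<close>, so conditions on dC3 carry over
    unchanged.\<close>
  define \<eta> where "\<eta> = rescaled_coframe \<theta> (\<lambda>p. 1) (\<lambda>p. C1 p / C3 p) (\<lambda>p. C2 p / C3 p)"
  have b: "smooth_fun A U (\<lambda>p. C1 p / C3 p)" "smooth_fun A U (\<lambda>p. C2 p / C3 p)"
    using C3 by (auto intro!: smooth_fun_divide sm)
  have "adaptation A U \<omega> \<eta>" "one_adapted A U \<epsilon> \<eta>" "invariant_C A U \<eta> C"
    unfolding \<eta>_def
    by (rule adaptation_rescaled[OF ad smooth_fun_const b], simp)
      (rule one_adapted_rescaled[OF one smooth_fun_const b], simp,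
        rule invariant_C_rescaled[OF cof C smooth_fun_const])
  moreover have "forms_eq A U (d0 C) (comb1 \<eta> (\<lambda>p. 0) (\<lambda>p. 0) C3)"
    using dC C3
    by (simp add: forms_eq_def comb1_def \<eta>_def rescaled_coframe_simps fun_eq_iff algebra_simps)
  ultimately show ?thesis by blast
qed

lemma transverse_case:
  assumes ad: "adaptation A U \<omega> \<theta>" and one: "one_adapted A U \<epsilon> \<theta>" and C: "invariant_C A U \<theta> C"
    and \<epsilon>: "\<epsilon> \<in> {1, -1}" and \<delta>: "\<delta> \<in> {1, -1}"
    and dC: "forms_eq A U (d0 C) (comb1 \<theta> (\<lambda>p. 0) (\<lambda>p. 0) C3)"
    and C3: "\<forall>p\<in>U. C3 p \<noteq> 0"
    and indep: "\<forall>c\<in>A. \<forall>p\<in>fst c \<inter> U. wedge11 (d0 C) (d0 C3) c p \<noteq> (\<lambda>u v. 0)"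
  shows "\<exists>\<eta> A1 A2 A3 \<zeta>.
            adaptation A U \<omega> \<eta> \<and>
            smooth_fun A U A1 \<and> smooth_fun A U A2 \<and> smooth_fun A U A3 \<and>
            smooth_angle A U \<zeta> \<and>
            forms_eq A U (d1 (\<eta> 1)) (comb2 \<eta> A2 (\<lambda>p. A3 p - C p) (\<lambda>p. 1)) \<and>
            forms_eq A U (d1 (\<eta> 2)) (comb2 \<eta> (\<lambda>p. - A1 p) (\<lambda>p. \<epsilon>) (\<lambda>p. A3 p + C p)) \<and>
            forms_eq A U (d1 (\<eta> 3)) (comb2 \<eta> (\<lambda>p. 0) (\<lambda>p. \<delta> * sin (\<zeta> p)) (\<lambda>p. cos (\<zeta> p))) \<and>
            forms_eq A U (d0 C) (comb1 \<eta> (\<lambda>p. 0) (\<lambda>p. 0) C3)"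
proof -
  have cof: "coframing_on A U \<theta>" using one by (simp add: one_adapted_def)
  have Cs: "smooth_fun A U C" by (rule invariant_C_smooth[OF C])
  have C3s: "smooth_fun A U C3" by (rule coefficients1_smooth(3)[OF cof one_form_on_d0[OF Cs] dC])
  obtain k1 k2 k3 where k: "smooth_fun A U k1" "smooth_fun A U k2" "smooth_fun A U k3"
    and dC3: "forms_eq A U (d0 C3) (comb1 \<theta> k1 k2 k3)"
    using coefficients1[OF cof one_form_on_d0[OF C3s]] by blast
  define e1 where "e1 p = - k1 p / C3 p" for p
  define e2 where "e2 p = - k2 p / C3 p" for p
  have e: "smooth_fun A U e1" "smooth_fun A U e2"
    unfolding e1_def e2_def using C3 by (auto intro!: smooth_fun_intros k C3s)
  \<comment> \<open>From d(C3 \<theta>3) = 0. The component \<open>k3\<close> of dC3 disappears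
    because it is wedged with \<open>\<theta> 3\<close>.\<close>
  have d3: "d1 (\<theta> 3) c p u v = e1 p * wedge11 (\<theta> 1) (\<theta> 3) c p u v + e2 p * wedge11 (\<theta> 2) (\<theta> 3) c p u v"
    if cp: "c \<in> A" "p \<in> fst c \<inter> U" for c p u v
  proof -
    have d0z: "d0 (\<lambda>p. 0) c p u = 0" for u
      using d0_eqI[OF has_derivative_const] by metis
    have "d0 C3 c p u = k1 p * \<theta> 1 c p u + k2 p * \<theta> 2 c p u + k3 p * \<theta> 3 c p u" for u
      using forms_eqD[OF dC3 cp] by (simp add: comb1_def)
    then have "C3 p * d1 (\<theta> 3) c p u v =
        - k1 p * wedge11 (\<theta> 1) (\<theta> 3) c p u v - k2 p * wedge11 (\<theta> 2) (\<theta> 3) c p u v"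
      using closed_d0_comb1[OF cof smooth_fun_const smooth_fun_const C3s Cs dC cp, of u v]
      by (simp add: d0z wedge11_def algebra_simps)
    moreover have "C3 p \<noteq> 0" using C3 cp by blast
    ultimately show ?thesis by (simp add: e1_def e2_def field_simps)
  qed
  \<comment> \<open>If both vanished at p, then dC and dC3 would both be multiples of
    \<open>\<theta> 3\<close> there, and their wedge product would be zero.\<close>
  have pos: "(e1 p)\<^sup>2 + (e2 p)\<^sup>2 > 0" if p: "p \<in> U" for p
  proof (rule ccontr)
    assume "\<not> ?thesis"
    then have "e1 p = 0" "e2 p = 0" by (simp_all add: sum_power2_gt_zero_iff)
    then have "k1 p = 0" "k2 p = 0" using C3 p by (simp_all add: e1_def e2_def)
    moreover obtain c where c: "c \<in> A" "p \<in> fst c" by (rule in_some_chart)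
    moreover have "d0 C3 c p = comb1 \<theta> k1 k2 k3 c p" "d0 C c p = comb1 \<theta> (\<lambda>p. 0) (\<lambda>p. 0) C3 c p"
      using forms_eqD[OF dC3 c(1)] forms_eqD[OF dC c(1)] c p by blast+
    ultimately have "wedge11 (d0 C) (d0 C3) c p = (\<lambda>u v. 0)"
      by (simp add: wedge11_def comb1_def fun_eq_iff)
    then show False using indep c p by blast
  qed
  define r where "r p = sqrt ((e1 p)\<^sup>2 + (e2 p)\<^sup>2)" for p
  have r: "smooth_fun A U r"
    unfolding r_def power2_eq_square
    by (intro smooth_fun_intros e) (use pos in \<open>simp add: power2_eq_square\<close>)
  have r_pos: "r p > 0" and rr: "r p * r p = (e1 p)\<^sup>2 + (e2 p)\<^sup>2" if "p \<in> U" for p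
    using pos[OF that] by (simp_all add: r_def)
  then have r0: "r p \<noteq> 0" if "p \<in> U" for p using that by fastforce
  \<comment> \<open>The pair is in swapped order: the cosine belongs to
    \<open>\<eta> 2 \<and> \<eta> 3\<close> and the sine, with \<delta>, to
    \<open>\<eta> 1 \<and> \<eta> 3\<close>.\<close>
  have "(e2 p / r p)\<^sup>2 + (\<delta> * (e1 p / r p))\<^sup>2 = 1" if "p \<in> U" for p
  proof -
    have "\<delta>\<^sup>2 = 1" using \<delta> by auto
    then have "(e2 p / r p)\<^sup>2 + (\<delta> * (e1 p / r p))\<^sup>2 = ((e1 p)\<^sup>2 + (e2 p)\<^sup>2) / (r p * r p)"
      by (simp add: power_mult_distrib power_divide add_divide_distrib power2_eq_square[of "r p"])
    then show ?thesis unfolding rr[OF that, symmetric] using r0[OF that] by simp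
  qed
  moreover have "smooth_fun A U (\<lambda>p. e2 p / r p)" "smooth_fun A U (\<lambda>p. \<delta> * (e1 p / r p))"
    using r0 by (auto intro!: smooth_fun_intros e r)
  ultimately obtain \<zeta> where \<zeta>: "smooth_angle A U \<zeta>"
    "\<forall>p\<in>U. cos (\<zeta> p) = e2 p / r p \<and> sin (\<zeta> p) = \<delta> * (e1 p / r p)"
    using smooth_angle_exists[of "\<lambda>p. e2 p / r p" "\<lambda>p. \<delta> * (e1 p / r p)"] by blast
  define \<eta> where "\<eta> = rescaled_coframe \<theta> r (\<lambda>p. 0) (\<lambda>p. 0)"
  have ad0: "adaptation A U \<omega> \<eta>"
    unfolding \<eta>_def by (rule adaptation_rescaled[OF ad r smooth_fun_const smooth_fun_const r0])
  have one0: "one_adapted A U \<epsilon> \<eta>"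
    unfolding \<eta>_def by (rule one_adapted_rescaled[OF one r smooth_fun_const smooth_fun_const r0])
  have inv0: "invariant_C A U \<eta> C"
    unfolding \<eta>_def by (rule invariant_C_rescaled[OF cof C r])
  have \<eta>: "\<eta> 1 = (\<lambda>c p v. r p * \<theta> 1 c p v)" "\<eta> 2 = (\<lambda>c p v. r p * \<theta> 2 c p v)" "\<eta> 3 = \<theta> 3"
    by (simp_all add: \<eta>_def rescaled_coframe_simps)
  have "forms_eq A U (d0 C) (comb1 \<eta> (\<lambda>p. 0) (\<lambda>p. 0) C3)"
    using dC by (simp add: forms_eq_def comb1_def \<eta>)
  moreover have "forms_eq A U (d1 (\<eta> 3)) (comb2 \<eta> (\<lambda>p. 0) (\<lambda>p. \<delta> * sin (\<zeta> p)) (\<lambda>p. cos (\<zeta> p)))"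
    unfolding forms_eq_def
  proof (intro ballI ext)
    fix c p u v assume cp: "c \<in> A" "p \<in> fst c \<inter> U"
    have "\<delta> * \<delta> = 1" using \<delta> by auto
    \<comment> \<open>The factor r is absorbed by the scaling: \<open>\<eta> 1\<close> and
      \<open>\<eta> 2\<close> carry it while \<open>\<eta> 3\<close> is
      \<open>\<theta> 3\<close>.\<close>
    then have "e1 p = \<delta> * sin (\<zeta> p) * r p" "e2 p = cos (\<zeta> p) * r p"
      using \<zeta>(2) cp r0[of p] by (simp_all flip: mult.assoc)
    then show "d1 (\<eta> 3) c p u v = comb2 \<eta> (\<lambda>p. 0) (\<lambda>p. \<delta> * sin (\<zeta> p)) (\<lambda>p. cos (\<zeta> p)) c p u v"
      by (simp add: \<eta> d3[OF cp] comb2_def wedge11_def algebra_simps)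
  qed
  ultimately show ?thesis
    using structure_equations[OF one0 inv0 \<epsilon>] ad0 \<zeta>(1) by blast
qed

end

text \<open>For nonvanishing \<open>C3\<close>, the condition C1 = C2 = 0 is a normalization reached
  by translating the third form, hence an existence claim. For vanishing \<open>C3\<close>, removing
  \<open>A1\<close> and \<open>A2\<close> is conditional on the nonvanishing of the translation
  determinant.\<close>

theorem theorem1:
  fixes A :: "('m::{t2_space,second_countable_topology}) chart set"
    and \<omega> \<theta> :: "3 \<Rightarrow> 'm form1"
    and \<epsilon> \<delta> :: real
    and C C1 C2 C3 :: "'m \<Rightarrow> real"
    and U :: "'m set"
  assumes M: "manifold3 A"
    and \<omega>: "coframing_on A UNIV \<omega>" "bicontact_on A UNIV (\<omega> 1) (\<omega> 2)"
    and signs: "\<epsilon> \<in> {1, -1}" "\<delta> \<in> {1, -1}"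
    and \<theta>: "adaptation A UNIV \<omega> \<theta>" "one_adapted A UNIV \<epsilon> \<theta>"
    and C: "invariant_C A UNIV \<theta> C"
    and dC: "forms_eq A UNIV (d0 C) (comb1 \<theta> C1 C2 C3)"
    and U: "open U"
    and noncritical: "\<forall>c\<in>A. \<forall>p\<in>fst c \<inter> U. d0 C c p \<noteq> (\<lambda>v. 0)"
  shows
    "((\<forall>p\<in>U. C3 p = 0) \<longrightarrow>
       (\<exists>\<eta> A1 A2 A3 B1 B2 B3 \<xi>.
          adaptation A U \<omega> \<eta> \<and>
          smooth_fun A U A1 \<and> smooth_fun A U A2 \<and> smooth_fun A U A3 \<and>
          smooth_fun A U B1 \<and> smooth_fun A U B2 \<and> smooth_fun A U B3 \<and>
          smooth_angle A U \<xi> \<and>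
          forms_eq A U (d1 (\<eta> 1)) (comb2 \<eta> A2 (\<lambda>p. A3 p - C p) (\<lambda>p. 1)) \<and>
          forms_eq A U (d1 (\<eta> 2)) (comb2 \<eta> (\<lambda>p. - A1 p) (\<lambda>p. \<epsilon>) (\<lambda>p. A3 p + C p)) \<and>
          forms_eq A U (d1 (\<eta> 3)) (comb2 \<eta> B3 B2 B1) \<and>
          forms_eq A U (d0 C) (comb1 \<eta> (\<lambda>p. cos (\<xi> p)) (\<lambda>p. \<delta> * sin (\<xi> p)) (\<lambda>p. 0)) \<and>
          ((\<forall>p\<in>U. translation_regular \<epsilon> (C p) (C1 p) (C2 p)) \<longrightarrow>
             (\<forall>p\<in>U. A1 p = 0 \<and> A2 p = 0))))
     \<and>
     ((\<forall>p\<in>U. C3 p \<noteq> 0) \<longrightarrow>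
       (\<exists>\<eta>. adaptation A U \<omega> \<eta> \<and> one_adapted A U \<epsilon> \<eta> \<and> invariant_C A U \<eta> C \<and>
          forms_eq A U (d0 C) (comb1 \<eta> (\<lambda>p. 0) (\<lambda>p. 0) C3)) \<and>
       ((\<forall>c\<in>A. \<forall>p\<in>fst c \<inter> U. wedge11 (d0 C) (d0 C3) c p \<noteq> (\<lambda>u v. 0)) \<longrightarrow>
         (\<exists>\<eta> A1 A2 A3 \<zeta>.
            adaptation A U \<omega> \<eta> \<and>
            smooth_fun A U A1 \<and> smooth_fun A U A2 \<and> smooth_fun A U A3 \<and>
            smooth_angle A U \<zeta> \<and>
            forms_eq A U (d1 (\<eta> 1)) (comb2 \<eta> A2 (\<lambda>p. A3 p - C p) (\<lambda>p. 1)) \<and>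
            forms_eq A U (d1 (\<eta> 2)) (comb2 \<eta> (\<lambda>p. - A1 p) (\<lambda>p. \<epsilon>) (\<lambda>p. A3 p + C p)) \<and>
            forms_eq A U (d1 (\<eta> 3)) (comb2 \<eta> (\<lambda>p. 0) (\<lambda>p. \<delta> * sin (\<zeta> p)) (\<lambda>p. cos (\<zeta> p))) \<and>
            forms_eq A U (d0 C) (comb1 \<eta> (\<lambda>p. 0) (\<lambda>p. 0) C3))))"
proof -
  interpret open_in_manifold3 A U
    by unfold_locales (rule M, rule U)
  have \<theta>': "adaptation A U \<omega> \<theta>" "one_adapted A U \<epsilon> \<theta>"
    and C': "invariant_C A U \<theta> C"
    and dC': "forms_eq A U (d0 C) (comb1 \<theta> C1 C2 C3)"
    using adaptation_subset[OF \<theta>(1)] one_adapted_subset[OF \<theta>(2)] invariant_C_subset[OF C]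
      forms_eq_subset[OF dC] by blast+
  note horizontal = horizontal_case[OF \<theta>' C' signs dC' noncritical]
  note transverse = transverse_coframe[OF \<theta>' C' dC']
  show ?thesis
  proof (intro conjI impI, goal_cases)
    case 1
    then show ?case by (rule horizontal)
  next
    case 2
    then show ?case by (rule transverse)
  next
    case 3
    \<comment> \<open>First translate so that dC is a multiple of the third form alone, then
      scale.\<close>
    then obtain \<eta> where "adaptation A U \<omega> \<eta>" "one_adapted A U \<epsilon> \<eta>" "invariant_C A U \<eta> C"
      "forms_eq A U (d0 C) (comb1 \<eta> (\<lambda>p. 0) (\<lambda>p. 0) C3)"
      using transverse by blast
    then show ?case by (rule transverse_case[OF _ _ _ signs _ 3])
  qed
qed


end
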